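(* For every set of variables $\Sigma$ and terms $s, t$ (with $s$ of type $\tau_1\to\cdots\to\tau_n\to\tau$ and $t$ of type $\tau$), the set $S(\Sigma,s,t)$ is a complete set of nominal abstraction solutions for $s \unrhd t$ on $\Sigma$.
   Context: Terms are simply typed $\lambda$-terms identified up to $\alpha\beta\eta$-conversion; constants are partitioned into nominal constants $\mathcal{C}$ and others; $\mathrm{supp}(t)$ is the set of nominal constants in $t$. A permutation $\pi$ is a type-preserving bijection of $\mathcal{C}$ moving finitely many elements, applied homomorphically to terms. A substitution is a type-preserving map from variables to terms that is the identity except on finitely many variables, written $\{t_1/x_1,\ldots,t_n/x_n\}$; $\mathrm{supp}(\theta)$ is the set of nominal constants in its range; $\theta\restriction\Sigma$ agrees with $\theta$ on $\Sigma$ and is the identity elsewhere; $\pi.\theta$ replaces each $t/x$ by $(\pi.t)/x$. $B[\theta]$ is ordinary substitution and $B\langle\theta\rangle=(\pi.B)[\theta]$ with $\pi$ any permutation mapping $\mathrm{supp}(B)$ outside $\mathrm{supp}(\theta)$. $\theta\circ\rho$ is the usual composition ($B[\theta\circ\rho]=B[\theta][\rho]$), and the nominal capture-avoiding composition is $\theta\bullet\rho=(\pi.\theta)\circ\rho$ for any $\pi$ with $\mathrm{supp}(\pi.\theta)\cap\mathrm{supp}(\rho)=\emptyset$. $\theta\approx\rho$ iff $\theta=\pi.\rho$ for some permutation $\pi$. $\rho\le\theta$ iff there is $\sigma$ with $\rho\approx\theta\bullet\sigma$, and $\rho\le_\Sigma\theta$ iff $\rho\restriction\Sigma\le\theta\restriction\Sigma$.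 The nominal abstraction $s\unrhd t$ of degree $n$ holds iff $s$ $\lambda$-converts to $\lambda c_1\ldots\lambda c_n.t$ (abstracting the nominal constants $c_i$ out of $t$) for some distinct nominal constants $c_i$; $\theta$ is a solution to $s\unrhd t$ iff $(s\unrhd t)\langle\theta\rangle$ (applying $\theta$ to the whole formula) holds. A complete set of nominal abstraction solutions of $s$ and $t$ on $\Sigma$ is a set $S$ of substitutions such that every $\theta\in S$ is a solution to $s\unrhd t$ and for every solution $\rho$ there is $\theta\in S$ with $\rho\le_\Sigma\theta$. For terms $u,v$, $\mathrm{CSU}(u,v)$ denotes an arbitrary fixed complete set of unifiers for the higher-order unification problem $u=v$. Definition of $S(\Sigma,s,t)$: let $c_1,\ldots,c_n$ be distinct nominal constants not in $\mathrm{supp}(s\unrhd t)$ with $c_i$ of type $\tau_i$; for each $h\in\Sigma$ of type $\tau'$ let $h'$ be a distinct new variable not in $\Sigma$ of type $\tau_1\to\cdots\to\tau_n\to\tau'$; let $\sigma=\{h'\ c_1\ \ldots\ c_n/h \mid h\in\Sigma\}$, $s'=s[\sigma]$, $t'=t[\sigma]$; let $C=\bigcup_{\vec a}\mathrm{CSU}(\lambda\vec b.s',\ \lambda\vec b.\lambda\vec a.t')$, where $\vec a=a_1,\ldots,a_n$ ranges over all selections of $n$ distinct nominal constants from $\mathrm{supp}(t)\cup\{c_1,\ldots,c_n\}$ with $a_i$ of type $\tau_i$, and $\vec b$ is a listing of all nominal constants of $s'$ and $t'$ not in $\vec a$ (here $\lambda$ over nominal constants means abstracting them out); then $S(\Sigma,s,t)=\{\sigma\bullet\rho\mid\rho\in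 C\}$.
   Formalization: Proved for finite Σ containing all free variables of s and t; ρ ≤_Σ θ compares the instance with ρ on Σ only; unifiers may not use nominal constants of the problem u=v, and each CSU is complete also on the raised variables h'. The literal statement fails without these. *)

theory Defs
  imports Main
begin

subsection \<open>Raw terms\<close>

text \<open>
  Raw terms are Church-style: bound variables are de Bruijn indices; free variables and nominal
  constants carry their type, so that there are infinitely many of each at every type.
\<close>

datatype ty = Base nat | Fun ty ty

datatype var = V nat (vty: ty)

datatype nom = N nat (nty: ty)

abbreviation Funs :: "ty list \<Rightarrow> ty \<Rightarrow> ty" where
  "Funs \<tau>s \<tau> \<equiv> foldr Fun \<tau>s \<tau>"

text \<open>
  The class fixes an arbitrary signature of non-nominal constants; names mapped to
  \<^const>\<open>None\<close> are not constants of the signature.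
\<close>

class signature =
  fixes const_ty :: "'a \<Rightarrow> ty option"

datatype 'k raw = Bnd nat | Free var | Nom nom | Cst 'k | App "'k raw" "'k raw" | Lam ty "'k raw"

fun tyof :: "ty list \<Rightarrow> 'k::signature raw \<Rightarrow> ty option" where
  "tyof \<Gamma> (Bnd i) = (if i < length \<Gamma> then Some (\<Gamma> ! i) else None)"
| "tyof \<Gamma> (Free x) = Some (vty x)"
| "tyof \<Gamma> (Nom c) = Some (nty c)"
| "tyof \<Gamma> (Cst k) = const_ty k"
| "tyof \<Gamma> (App r u) =
    (case tyof \<Gamma> r of
       Some (Fun A B) \<Rightarrow> if tyof \<Gamma> u = Some A then Some B else None
     | _ \<Rightarrow> None)"
| "tyof \<Gamma> (Lam A r) = map_option (Fun A) (tyof (A # \<Gamma>) r)"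

primrec lift :: "nat \<Rightarrow> 'k raw \<Rightarrow> 'k raw" where
  "lift k (Bnd i) = (if i < k then Bnd i else Bnd (Suc i))"
| "lift k (Free x) = Free x"
| "lift k (Nom c) = Nom c"
| "lift k (Cst a) = Cst a"
| "lift k (App r u) = App (lift k r) (lift k u)"
| "lift k (Lam A r) = Lam A (lift (Suc k) r)"

primrec inst :: "nat \<Rightarrow> 'k raw \<Rightarrow> 'k raw \<Rightarrow> 'k raw" where
  "inst k w (Bnd i) = (if i < k then Bnd i else if i = k then w else Bnd (i - 1))"
| "inst k w (Free x) = Free x"
| "inst k w (Nom c) = Nom c"
| "inst k w (Cst a) = Cst a"
| "inst k w (App r u) = App (inst k w r) (inst k w u)"
| "inst k w (Lam A r) = Lam A (inst (Suc k) (lift 0 w) r)"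

inductive conv :: "ty list \<Rightarrow> ty \<Rightarrow> 'k::signature raw \<Rightarrow> 'k raw \<Rightarrow> bool" where
  conv_refl: "tyof \<Gamma> r = Some A \<Longrightarrow> conv \<Gamma> A r r"
| conv_sym: "conv \<Gamma> A r r' \<Longrightarrow> conv \<Gamma> A r' r"
| conv_trans: "conv \<Gamma> A r r' \<Longrightarrow> conv \<Gamma> A r' r'' \<Longrightarrow> conv \<Gamma> A r r''"
| conv_App: "conv \<Gamma> (Fun A B) r r' \<Longrightarrow> conv \<Gamma> A u u' \<Longrightarrow> conv \<Gamma> B (App r u) (App r' u')"
| conv_Lam: "conv (A # \<Gamma>) B r r' \<Longrightarrow> conv \<Gamma> (Fun A B) (Lam A r) (Lam A r')"
| conv_beta: "tyof (A # \<Gamma>) r = Some B \<Longrightarrow> tyof \<Gamma> u = Some A \<Longrightarrow>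
    conv \<Gamma> B (App (Lam A r) u) (inst 0 u r)"
| conv_eta: "tyof \<Gamma> r = Some (Fun A B) \<Longrightarrow>
    conv \<Gamma> (Fun A B) (Lam A (App (lift 0 r) (Bnd 0))) r"

lemma tyof_lift:
  "tyof (\<Gamma> @ \<Delta>) r = Some B \<Longrightarrow> tyof (\<Gamma> @ A # \<Delta>) (lift (length \<Gamma>) r) = Some B"
proof (induction r arbitrary: \<Gamma> B)
  case (Bnd i)
  then show ?case by (auto simp: nth_append Suc_diff_le split: if_splits)
next
  case (App r u)
  then show ?case by (fastforce split: option.splits ty.splits if_splits)
next
  case (Lam C r)
  from Lam.prems obtain D where D: "tyof ((C # \<Gamma>) @ \<Delta>) r = Some D" "B = Fun C D" by auto
  from Lam.IH[OF D(1)] D(2) show ?case by simp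
qed auto

lemma tyof_inst:
  "tyof (\<Gamma> @ A # \<Delta>) r = Some B \<Longrightarrow> tyof (\<Gamma> @ \<Delta>) w = Some A \<Longrightarrow>
   tyof (\<Gamma> @ \<Delta>) (inst (length \<Gamma>) w r) = Some B"
proof (induction r arbitrary: \<Gamma> B w)
  case (Bnd i)
  show ?case
  proof (cases "i \<le> length \<Gamma>")
    case True
    with Bnd show ?thesis by (auto simp: nth_append split: if_splits)
  next
    case False
    then obtain j where "i = Suc (length \<Gamma> + j)" by (metis less_imp_Suc_add not_le)
    with Bnd show ?thesis by (auto simp: nth_append split: if_splits)
  qed
next
  case (App r u)
  then show ?case by (fastforce split: option.splits ty.splits if_splits)
next
  case (Lam C r)
  from Lam.prems obtain D where D: "tyof ((C # \<Gamma>) @ A # \<Delta>) r = Some D" "B = Fun C D" by auto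
  have "tyof ((C # \<Gamma>) @ \<Delta>) (lift 0 w) = Some A"
    using tyof_lift[of "[]" "\<Gamma> @ \<Delta>" w A C] Lam.prems(2) by simp
  from Lam.IH[OF D(1) this] D(2) show ?case by simp
qed auto

lemma conv_tyof: "conv \<Gamma> A r r' \<Longrightarrow> tyof \<Gamma> r = Some A \<and> tyof \<Gamma> r' = Some A"
proof (induction rule: conv.induct)
  case (conv_beta A \<Gamma> r B u)
  then show ?case using tyof_inst[of "[]" A \<Gamma> r B u] by simp
next
  case (conv_eta \<Gamma> r A B)
  then show ?case using tyof_lift[of "[]" \<Gamma> r "Fun A B" A] by simp
qed auto

definition eqv :: "'k::signature raw \<Rightarrow> 'k raw \<Rightarrow> bool" where
  "eqv r r' \<longleftrightarrow> (\<exists>A. conv [] A r r')"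

primrec noms :: "'k raw \<Rightarrow> nom set" where
  "noms (Bnd i) = {}"
| "noms (Free x) = {}"
| "noms (Nom c) = {c}"
| "noms (Cst k) = {}"
| "noms (App r u) = noms r \<union> noms u"
| "noms (Lam A r) = noms r"

primrec frees :: "'k raw \<Rightarrow> var set" where
  "frees (Bnd i) = {}"
| "frees (Free x) = {x}"
| "frees (Nom c) = {}"
| "frees (Cst k) = {}"
| "frees (App r u) = frees r \<union> frees u"
| "frees (Lam A r) = frees r"

primrec raw_perm :: "(nom \<Rightarrow> nom) \<Rightarrow> 'k raw \<Rightarrow> 'k raw" where
  "raw_perm \<pi> (Bnd i) = Bnd i"
| "raw_perm \<pi> (Free x) = Free x"
| "raw_perm \<pi> (Nom c) = Nom (\<pi> c)"
| "raw_perm \<pi> (Cst k) = Cst k"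
| "raw_perm \<pi> (App r u) = App (raw_perm \<pi> r) (raw_perm \<pi> u)"
| "raw_perm \<pi> (Lam A r) = Lam A (raw_perm \<pi> r)"

text \<open>No lifting under \<^const>\<open>Lam\<close>: only used for \<open>\<theta>\<close> whose values have no dangling indices.\<close>

primrec raw_subst :: "(var \<Rightarrow> 'k raw) \<Rightarrow> 'k raw \<Rightarrow> 'k raw" where
  "raw_subst \<theta> (Bnd i) = Bnd i"
| "raw_subst \<theta> (Free x) = \<theta> x"
| "raw_subst \<theta> (Nom c) = Nom c"
| "raw_subst \<theta> (Cst k) = Cst k"
| "raw_subst \<theta> (App r u) = App (raw_subst \<theta> r) (raw_subst \<theta> u)"
| "raw_subst \<theta> (Lam A r) = Lam A (raw_subst \<theta> r)"

primrec raw_close :: "nat \<Rightarrow> nom \<Rightarrow> 'k raw \<Rightarrow> 'k raw" where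
  "raw_close k c (Bnd i) = (if i < k then Bnd i else Bnd (Suc i))"
| "raw_close k c (Free x) = Free x"
| "raw_close k c (Nom d) = (if d = c then Bnd k else Nom d)"
| "raw_close k c (Cst a) = Cst a"
| "raw_close k c (App r u) = App (raw_close k c r) (raw_close k c u)"
| "raw_close k c (Lam A r) = Lam A (raw_close (Suc k) c r)"


subsection \<open>Terms\<close>

text \<open>Closed (no dangling index) well-typed raw terms modulo conversion.\<close>

quotient_type (overloaded) 'k tm = "'k::signature raw" / partial: eqv
proof (rule part_equivpI)
  show "\<exists>r::'k raw. eqv r r"
    unfolding eqv_def by (metis conv_refl tyof.simps(2))
  show "symp (eqv :: 'k raw \<Rightarrow> _)"
    unfolding eqv_def by (auto intro!: sympI dest: conv_sym)
  show "transp (eqv :: 'k raw \<Rightarrow> _)"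
  proof (rule transpI)
    fix r r' r'' :: "'k raw"
    assume "eqv r r'" "eqv r' r''"
    then obtain A B where AB: "conv [] A r r'" "conv [] B r' r''" unfolding eqv_def by blast
    from AB have "A = B" using conv_tyof by (metis option.inject)
    with AB show "eqv r r''" unfolding eqv_def by (blast intro: conv_trans)
  qed
qed

definition tm_ty :: "'k::signature tm \<Rightarrow> ty" where
  "tm_ty t = the (tyof [] (rep_tm t))"

definition tm_var :: "var \<Rightarrow> 'k::signature tm" where
  "tm_var x = abs_tm (Free x)"

definition tm_perm :: "(nom \<Rightarrow> nom) \<Rightarrow> 'k::signature tm \<Rightarrow> 'k tm" where
  "tm_perm \<pi> t = abs_tm (raw_perm \<pi> (rep_tm t))"

definition lam_nom :: "nom \<Rightarrow> 'k::signature tm \<Rightarrow> 'k tm" where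
  "lam_nom c t = abs_tm (Lam (nty c) (raw_close 0 c (rep_tm t)))"

abbreviation lam_noms :: "nom list \<Rightarrow> 'k::signature tm \<Rightarrow> 'k tm" where
  "lam_noms cs t \<equiv> foldr lam_nom cs t"

text \<open>
  Convertible raw terms may differ in vacuous occurrences (contracting a redex can erase its
  argument), so a symbol occurs in a term if it occurs in every representative. As reduction never
  creates occurrences, these are the symbols of the normal form.
\<close>

definition supp :: "'k::signature tm \<Rightarrow> nom set" where
  "supp t = (\<Inter>r \<in> {r. eqv (rep_tm t) r}. noms r)"

definition fv :: "'k::signature tm \<Rightarrow> var set" where
  "fv t = (\<Inter>r \<in> {r. eqv (rep_tm t) r}. frees r)"

definition is_perm :: "(nom \<Rightarrow> nom) \<Rightarrow> bool" where
  "is_perm \<pi> \<longleftrightarrow> bij \<pi> \<and> (\<forall>c. nty (\<pi> c) = nty c) \<and> finite {c. \<pi> c \<noteq> c}"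


subsection \<open>Substitutions\<close>

type_synonym 'k subst = "var \<Rightarrow> 'k tm"

definition is_subst :: "'k::signature subst \<Rightarrow> bool" where
  "is_subst \<theta> \<longleftrightarrow> (\<forall>x. tm_ty (\<theta> x) = vty x) \<and> finite {x. \<theta> x \<noteq> tm_var x}"

definition tm_subst :: "'k::signature tm \<Rightarrow> 'k subst \<Rightarrow> 'k tm" where
  "tm_subst t \<theta> = abs_tm (raw_subst (\<lambda>x. rep_tm (\<theta> x)) (rep_tm t))"

definition supp_subst :: "'k::signature subst \<Rightarrow> nom set" where
  "supp_subst \<theta> = (\<Union>x. supp (\<theta> x))"

definition restr :: "var set \<Rightarrow> 'k::signature subst \<Rightarrow> 'k subst" where
  "restr \<Sigma> \<theta> = (\<lambda>x. if x \<in> \<Sigma> then \<theta> x else tm_var x)"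

definition perm_subst :: "(nom \<Rightarrow> nom) \<Rightarrow> 'k::signature subst \<Rightarrow> 'k subst" where
  "perm_subst \<pi> \<theta> = (\<lambda>x. tm_perm \<pi> (\<theta> x))"

definition comp_subst :: "'k::signature subst \<Rightarrow> 'k subst \<Rightarrow> 'k subst" where
  "comp_subst \<theta> \<rho> = (\<lambda>x. tm_subst (\<theta> x) \<rho>)"

definition nom_comp :: "'k::signature subst \<Rightarrow> 'k subst \<Rightarrow> 'k subst" where
  "nom_comp \<theta> \<rho> =
    (let \<pi> = SOME \<pi>. is_perm \<pi> \<and> supp_subst (perm_subst \<pi> \<theta>) \<inter> supp_subst \<rho> = {}
     in comp_subst (perm_subst \<pi> \<theta>) \<rho>)"

definition subst_equiv :: "'k::signature subst \<Rightarrow> 'k subst \<Rightarrow> bool" where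
  "subst_equiv \<theta> \<rho> \<longleftrightarrow> (\<exists>\<pi>. is_perm \<pi> \<and> \<theta> = perm_subst \<pi> \<rho>)"

text \<open>
  The instance \<open>\<theta>\<restriction>\<Sigma> \<bullet> \<sigma>\<close> is compared with \<open>\<rho>\<restriction>\<Sigma>\<close> on \<open>\<Sigma>\<close> only: off \<open>\<Sigma>\<close> it coincides with
  \<open>\<sigma>\<close>, which must be free to instantiate the variables that \<open>\<theta>\<close> introduces.
\<close>

definition less_general_on :: "var set \<Rightarrow> 'k::signature subst \<Rightarrow> 'k subst \<Rightarrow> bool" where
  "less_general_on \<Sigma> \<rho> \<theta> \<longleftrightarrow>
    (\<exists>\<sigma>. is_subst \<sigma> \<and> subst_equiv (restr \<Sigma> \<rho>) (restr \<Sigma> (nom_comp (restr \<Sigma> \<theta>) \<sigma>)))"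


subsection \<open>Nominal abstraction\<close>

context
  notes [[typedef_overloaded]]
begin

datatype 'k formula = NAbs nat "'k::signature tm" "'k tm"

end

primrec supp_form :: "'k::signature formula \<Rightarrow> nom set" where
  "supp_form (NAbs n s t) = supp s \<union> supp t"

primrec perm_form :: "(nom \<Rightarrow> nom) \<Rightarrow> 'k::signature formula \<Rightarrow> 'k formula" where
  "perm_form \<pi> (NAbs n s t) = NAbs n (tm_perm \<pi> s) (tm_perm \<pi> t)"

primrec subst_form :: "'k::signature formula \<Rightarrow> 'k subst \<Rightarrow> 'k formula" where
  "subst_form (NAbs n s t) \<theta> = NAbs n (tm_subst s \<theta>) (tm_subst t \<theta>)"

definition nom_subst_form :: "'k::signature formula \<Rightarrow> 'k subst \<Rightarrow> 'k formula" where
  "nom_subst_form B \<theta> =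
    (let \<pi> = SOME \<pi>. is_perm \<pi> \<and> \<pi> ` supp_form B \<inter> supp_subst \<theta> = {}
     in subst_form (perm_form \<pi> B) \<theta>)"

primrec holds :: "'k::signature formula \<Rightarrow> bool" where
  "holds (NAbs n s t) \<longleftrightarrow> (\<exists>cs. length cs = n \<and> distinct cs \<and> s = lam_noms cs t)"

definition na_solution :: "'k::signature formula \<Rightarrow> 'k subst \<Rightarrow> bool" where
  "na_solution B \<theta> \<longleftrightarrow> is_subst \<theta> \<and> holds (nom_subst_form B \<theta>)"

definition complete_na_solutions ::
  "var set \<Rightarrow> 'k::signature formula \<Rightarrow> 'k subst set \<Rightarrow> bool" where
  "complete_na_solutions \<Sigma> B S \<longleftrightarrow>
    (\<forall>\<theta> \<in> S. na_solution B \<theta>) \<and>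
    (\<forall>\<rho>. na_solution B \<rho> \<longrightarrow> (\<exists>\<theta> \<in> S. less_general_on \<Sigma> \<rho> \<theta>))"


subsection \<open>Complete sets of unifiers\<close>

text \<open>
  The nominal constants occurring in a unification problem are scoped inside its unknowns, so a
  unifier may not mention them. For problems without nominal constants this is the usual notion.
\<close>

definition unifier :: "'k::signature tm \<Rightarrow> 'k tm \<Rightarrow> 'k subst \<Rightarrow> bool" where
  "unifier u v \<theta> \<longleftrightarrow>
    is_subst \<theta> \<and> tm_subst u \<theta> = tm_subst v \<theta> \<and> supp_subst \<theta> \<inter> (supp u \<union> supp v) = {}"

text \<open>
  Completeness is relative to a set \<open>W\<close> of protected variables: the auxiliary variables introduced
  by a unifier must not interfere with those in \<open>W\<close>, even if they are not free in the problem.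
\<close>

definition complete_unifiers ::
  "var set \<Rightarrow> 'k::signature tm \<Rightarrow> 'k tm \<Rightarrow> 'k subst set \<Rightarrow> bool" where
  "complete_unifiers W u v U \<longleftrightarrow>
    (\<forall>\<theta> \<in> U. unifier u v \<theta>) \<and>
    (\<forall>\<rho>. unifier u v \<rho> \<longrightarrow>
      (\<exists>\<theta> \<in> U. \<exists>\<gamma>. is_subst \<gamma> \<and> (\<forall>x \<in> W \<union> fv u \<union> fv v. \<rho> x = comp_subst \<theta> \<gamma> x)))"


subsection \<open>The set of solutions obtained by raising and unification\<close>

text \<open>
  The arbitrary choices made in the construction are parameters: the fresh nominal constants
  \<open>cs\<close>, the raised variables \<open>h' = prime h\<close>, the listing \<open>bs as\<close> of the remaining nominal constants
  for a selection \<open>as\<close>, and the complete sets of unifiers \<open>CSU\<close>.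
\<close>

definition raising :: "var set \<Rightarrow> (var \<Rightarrow> var) \<Rightarrow> nom list \<Rightarrow> 'k::signature subst" where
  "raising \<Sigma> prime cs =
    (\<lambda>h. if h \<in> \<Sigma> then abs_tm (foldl App (Free (prime h)) (map Nom cs)) else tm_var h)"

definition selections :: "'k::signature tm \<Rightarrow> nom list \<Rightarrow> nom list set" where
  "selections t cs =
    {as. distinct as \<and> set as \<subseteq> supp t \<union> set cs \<and> map nty as = map nty cs}"

definition solution_set ::
  "(var \<Rightarrow> var) \<Rightarrow> nom list \<Rightarrow> (nom list \<Rightarrow> nom list) \<Rightarrow>
   ('k tm \<Rightarrow> 'k tm \<Rightarrow> 'k subst set) \<Rightarrow>
   var set \<Rightarrow> 'k::signature tm \<Rightarrow> 'k tm \<Rightarrow> 'k subst set" where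
  "solution_set prime cs bs CSU \<Sigma> s t =
    (let \<sigma> = raising \<Sigma> prime cs;
         s' = tm_subst s \<sigma>;
         t' = tm_subst t \<sigma>;
         C = (\<Union>as \<in> selections t cs.
                CSU (lam_noms (bs as) s') (lam_noms (bs as) (lam_noms as t')))
     in {nom_comp \<sigma> \<rho> | \<rho>. \<rho> \<in> C})"

end

theory Submission
  imports Defs "HOL-Combinatorics.Transposition"
begin

text \<open>
  Soundness: a permutation that fixes the constants left free in the unification problem and moves
  all others away from the unifier \<open>\<rho>\<close> lets \<open>\<rho>\<close> commute with the abstractions; stripping \<open>\<lambda>\<close> over
  \<open>bs\<close> leaves the nominal abstraction itself.

  Completeness: after a renaming, a solution \<open>\<rho>\<close> satisfies \<open>s[\<rho>] = \<lambda>as. t[\<rho>]\<close> for a selection \<open>as\<close>,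
  and \<open>h' \<mapsto> \<lambda>cs. \<rho> h\<close> is a unifier. A member \<open>\<theta>\<close> of the complete set that covers it by \<open>\<theta> \<circ> \<gamma>\<close> may
  share nominal constants with \<open>\<gamma>\<close>, whereas \<open>\<bullet>\<close> keeps them apart. So the constants of the unifier are
  first replaced by fresh variables: if \<open>\<theta> \<circ> \<gamma>\<close> mentions no constants at all, renaming those of \<open>\<gamma>\<close> alone
  does not change it. This is a property of \<open>\<beta>\<eta>\<close>-conversion (identifying constants cannot erase
  them); it follows from the completeness of Crary-style type-directed algorithmic equality, proved by
  a logical relation over closed terms in which nominal constants serve as generic arguments.
\<close>

subsection \<open>Typing and conversion of raw terms\<close>

lemma tyof_App:
  "tyof \<Gamma> (App r u) = Some B \<longleftrightarrow> (\<exists>A. tyof \<Gamma> r = Some (Fun A B) \<and> tyof \<Gamma> u = Some A)"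
  by (auto split: option.splits ty.splits)

declare tyof.simps(5) [simp del] tyof_App [simp]

lemma tyof_induct [consumes 1, case_names Bnd Free Nom Cst App Lam]:
  assumes "tyof \<Gamma> r = Some A"
    and "\<And>\<Gamma> i. i < length \<Gamma> \<Longrightarrow> P \<Gamma> (Bnd i) (\<Gamma> ! i)"
    and "\<And>\<Gamma> x. P \<Gamma> (Free x) (vty x)"
    and "\<And>\<Gamma> c. P \<Gamma> (Nom c) (nty c)"
    and "\<And>\<Gamma> k A. const_ty k = Some A \<Longrightarrow> P \<Gamma> (Cst k) A"
    and "\<And>\<Gamma> r u A B. tyof \<Gamma> r = Some (Fun A B) \<Longrightarrow> tyof \<Gamma> u = Some A \<Longrightarrow>
      P \<Gamma> r (Fun A B) \<Longrightarrow> P \<Gamma> u A \<Longrightarrow> P \<Gamma> (App r u) B"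
    and "\<And>\<Gamma> A r B. tyof (A # \<Gamma>) r = Some B \<Longrightarrow> P (A # \<Gamma>) r B \<Longrightarrow> P \<Gamma> (Lam A r) (Fun A B)"
  shows "P \<Gamma> r A"
  using assms(1)
proof (induction r arbitrary: \<Gamma> A)
  case (App r u)
  then show ?case using assms(6) by auto
next
  case (Lam C r)
  then show ?case using assms(7) by auto
qed (auto intro: assms(2-5) split: if_splits)

lemma tyof_append: "tyof \<Gamma> r = Some A \<Longrightarrow> tyof (\<Gamma> @ \<Delta>) r = Some A"
  by (induction rule: tyof_induct) (auto simp: nth_append)

lemma tyof_closed: "tyof [] r = Some A \<Longrightarrow> tyof \<Gamma> r = Some A"
  using tyof_append[of "[]"] by simp

lemma conv_append: "conv \<Gamma> A r r' \<Longrightarrow> conv (\<Gamma> @ \<Delta>) A r r'"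
proof (induction rule: conv.induct)
  case (conv_beta A \<Gamma> r B u)
  then show ?case
    using tyof_append[of "A # \<Gamma>" r B \<Delta>] by (simp add: conv.conv_beta tyof_append)
next
  case (conv_Lam A \<Gamma> B r r')
  then show ?case by (simp add: conv.conv_Lam)
qed (blast intro: conv.intros tyof_append)+

lemma conv_closed: "conv [] A r r' \<Longrightarrow> conv \<Gamma> A r r'"
  using conv_append[of "[]"] by simp

lemma lift_above: "tyof \<Gamma> r = Some A \<Longrightarrow> length \<Gamma> \<le> k \<Longrightarrow> lift k r = r"
  by (induction arbitrary: k rule: tyof_induct) auto

lemma inst_above: "tyof \<Gamma> r = Some A \<Longrightarrow> length \<Gamma> \<le> k \<Longrightarrow> inst k w r = r"
  by (induction arbitrary: k w rule: tyof_induct) auto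

lemma lift_closed: "tyof [] r = Some A \<Longrightarrow> lift k r = r"
  by (simp add: lift_above)

lemma inst_closed: "tyof [] r = Some A \<Longrightarrow> inst k w r = r"
  by (simp add: inst_above)

lemma inst_lift_cancel: "inst k w (lift k r) = r"
  by (induction r arbitrary: k w) auto

lemma inst_lift:
  assumes "tyof [] w = Some A"
  shows "j \<le> k \<Longrightarrow> inst (Suc k) w (lift j r) = lift j (inst k w r)"
  by (induction r arbitrary: j k) (auto simp: lift_closed[OF assms])

lemma inst_inst:
  assumes "tyof [] w = Some A"
  shows "j \<le> k \<Longrightarrow> inst k w (inst j u r) = inst j (inst k w u) (inst (Suc k) w r)"
  by (induction r arbitrary: j k u)
    (auto simp: lift_closed[OF assms] inst_closed[OF assms] inst_lift[OF assms])

lemma finite_noms [simp]: "finite (noms r)"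
  by (induction r) auto

lemma finite_frees [simp]: "finite (frees r)"
  by (induction r) auto

lemma noms_lift [simp]: "noms (lift k r) = noms r"
  by (induction r arbitrary: k) auto

lemma noms_inst: "noms (inst k w r) \<subseteq> noms r \<union> noms w"
proof (induction r arbitrary: k w)
  case (App r u)
  then show ?case by fastforce
next
  case (Lam A r)
  then show ?case using Lam.IH[of "Suc k" "lift 0 w"] by simp
qed auto


subsection \<open>Replacing nominal constants and variables\<close>

primrec raw_map :: "(nom \<Rightarrow> 'k raw) \<Rightarrow> (var \<Rightarrow> 'k raw) \<Rightarrow> 'k raw \<Rightarrow> 'k raw" where
  "raw_map f \<theta> (Bnd i) = Bnd i"
| "raw_map f \<theta> (Free x) = \<theta> x"
| "raw_map f \<theta> (Nom c) = f c"
| "raw_map f \<theta> (Cst k) = Cst k"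
| "raw_map f \<theta> (App r u) = App (raw_map f \<theta> r) (raw_map f \<theta> u)"
| "raw_map f \<theta> (Lam A r) = Lam A (raw_map f \<theta> r)"

definition raw_typed :: "(nom \<Rightarrow> 'k::signature raw) \<Rightarrow> (var \<Rightarrow> 'k raw) \<Rightarrow> bool" where
  "raw_typed f \<theta> \<longleftrightarrow>
    (\<forall>c. tyof [] (f c) = Some (nty c)) \<and> (\<forall>x. tyof [] (\<theta> x) = Some (vty x))"

lemma raw_typed_closed:
  assumes "raw_typed f \<theta>"
  shows "tyof \<Gamma> (f c) = Some (nty c)" "tyof \<Gamma> (\<theta> x) = Some (vty x)"
    and "lift k (f c) = f c" "lift k (\<theta> x) = \<theta> x"
    and "inst k w (f c) = f c" "inst k w (\<theta> x) = \<theta> x"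
  using assms by (auto simp: raw_typed_def intro: tyof_closed lift_closed inst_closed)

lemma raw_perm_eq_raw_map: "raw_perm \<pi> r = raw_map (\<lambda>c. Nom (\<pi> c)) Free r"
  by (induction r) auto

lemma raw_subst_eq_raw_map: "raw_subst \<theta> r = raw_map Nom \<theta> r"
  by (induction r) auto

lemma raw_map_ident [simp]: "raw_map Nom Free r = r"
  by (induction r) auto

lemma raw_map_raw_map:
  "raw_map f \<theta> (raw_map g \<eta> r) = raw_map (\<lambda>c. raw_map f \<theta> (g c)) (\<lambda>x. raw_map f \<theta> (\<eta> x)) r"
  by (induction r) auto

lemma raw_map_cong:
  "(\<And>c. c \<in> noms r \<Longrightarrow> f c = f' c) \<Longrightarrow> (\<And>x. x \<in> frees r \<Longrightarrow> \<theta> x = \<theta>' x) \<Longrightarrow>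
   raw_map f \<theta> r = raw_map f' \<theta>' r"
  by (induction r) auto

lemma noms_raw_map:
  "noms (raw_map f \<theta> r) = (\<Union>c\<in>noms r. noms (f c)) \<union> (\<Union>x\<in>frees r. noms (\<theta> x))"
  by (induction r) auto

lemma frees_raw_map:
  "frees (raw_map f \<theta> r) = (\<Union>c\<in>noms r. frees (f c)) \<union> (\<Union>x\<in>frees r. frees (\<theta> x))"
  by (induction r) auto

lemma tyof_raw_map:
  assumes "raw_typed f \<theta>"
  shows "tyof \<Gamma> r = Some A \<Longrightarrow> tyof \<Gamma> (raw_map f \<theta> r) = Some A"
  by (induction rule: tyof_induct) (auto simp: raw_typed_closed[OF assms])

lemma raw_map_lift:
  assumes "raw_typed f \<theta>"
  shows "raw_map f \<theta> (lift k r) = lift k (raw_map f \<theta> r)"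
  by (induction r arbitrary: k) (auto simp: raw_typed_closed[OF assms])

lemma raw_map_inst:
  assumes "raw_typed f \<theta>"
  shows "raw_map f \<theta> (inst k w r) = inst k (raw_map f \<theta> w) (raw_map f \<theta> r)"
  by (induction r arbitrary: k w) (auto simp: raw_typed_closed[OF assms] raw_map_lift[OF assms])

lemma conv_raw_map:
  assumes "raw_typed f \<theta>"
  shows "conv \<Gamma> A r r' \<Longrightarrow> conv \<Gamma> A (raw_map f \<theta> r) (raw_map f \<theta> r')"
proof (induction rule: conv.induct)
  case (conv_beta A \<Gamma> r B u)
  then show ?case
    by (simp add: raw_map_inst[OF assms] conv.conv_beta tyof_raw_map[OF assms])
next
  case (conv_eta \<Gamma> r A B)
  then show ?case
    by (simp add: raw_map_lift[OF assms] conv.conv_eta tyof_raw_map[OF assms])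
next
  case (conv_trans \<Gamma> A r r' r'')
  then show ?case by (blast intro: conv.conv_trans)
qed (auto intro: conv.intros tyof_raw_map[OF assms])

lemma raw_map_conv_cong:
  assumes "tyof \<Gamma> r = Some A"
    and "\<And>c. conv [] (nty c) (f c) (f' c)" and "\<And>x. conv [] (vty x) (\<theta> x) (\<theta>' x)"
  shows "conv \<Gamma> A (raw_map f \<theta> r) (raw_map f' \<theta>' r)"
  using assms(1)
proof (induction rule: tyof_induct)
  case (App \<Gamma> r u A B)
  then show ?case by (auto intro: conv_App)
qed (auto intro: conv_closed assms(2,3) conv_Lam conv_refl)


subsection \<open>Abstracting a nominal constant\<close>

lemma noms_raw_close [simp]: "noms (raw_close k c r) = noms r - {c}"
  by (induction r arbitrary: k) auto

lemma tyof_raw_close: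
  "tyof (\<Gamma> @ \<Delta>) r = Some B \<Longrightarrow> tyof (\<Gamma> @ nty c # \<Delta>) (raw_close (length \<Gamma>) c r) = Some B"
proof (induction "\<Gamma> @ \<Delta>" r B arbitrary: \<Gamma> rule: tyof_induct)
  case (Lam A r B)
  then show ?case using Lam.hyps(2)[of "A # \<Gamma>"] by simp
qed (auto simp: nth_append Suc_diff_le)

lemma raw_close_lift: "j \<le> k \<Longrightarrow> raw_close (Suc k) c (lift j r) = lift j (raw_close k c r)"
  by (induction r arbitrary: j k) auto

lemma raw_close_inst:
  "j \<le> k \<Longrightarrow> raw_close k c (inst j w r) = inst j (raw_close k c w) (raw_close (Suc k) c r)"
  by (induction r arbitrary: j k w) (auto simp: raw_close_lift)

lemma raw_close_fresh: "c \<notin> noms r \<Longrightarrow> raw_close k c r = lift k r"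
  by (induction r arbitrary: k) auto

lemma inst_raw_close:
  "tyof \<Gamma> r = Some A \<Longrightarrow> length \<Gamma> \<le> k \<Longrightarrow> inst k (Nom c) (raw_close k c r) = r"
  by (induction arbitrary: k rule: tyof_induct) auto

lemma conv_raw_close:
  "conv (\<Gamma> @ \<Delta>) A r r' \<Longrightarrow>
   conv (\<Gamma> @ nty c # \<Delta>) A (raw_close (length \<Gamma>) c r) (raw_close (length \<Gamma>) c r')"
proof (induction "\<Gamma> @ \<Delta>" A r r' arbitrary: \<Gamma> rule: conv.induct)
  case (conv_Lam A B r r')
  then show ?case using conv_Lam.hyps(2)[of "A # \<Gamma>"] by (simp add: conv.conv_Lam)
next
  case (conv_beta A r B u)
  then show ?case
    using tyof_raw_close[of "A # \<Gamma>" \<Delta> r B c] tyof_raw_close[of \<Gamma> \<Delta> u A c]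
    by (simp add: raw_close_inst conv.conv_beta)
next
  case (conv_eta r A B)
  then show ?case by (simp add: raw_close_lift conv.conv_eta tyof_raw_close)
next
  case (conv_trans A r r' r'')
  then show ?case by (blast intro: conv.conv_trans)
qed (auto intro: conv.intros tyof_raw_close)

lemma conv_ext:
  assumes "conv [] B (App s (Nom c)) (App t (Nom c))" and "c \<notin> noms s \<union> noms t"
    and "tyof [] s = Some (Fun (nty c) B)" "tyof [] t = Some (Fun (nty c) B)"
  shows "conv [] (Fun (nty c) B) s t"
proof -
  have "conv [nty c] B (App (lift 0 s) (Bnd 0)) (App (lift 0 t) (Bnd 0))"
    using conv_raw_close[of "[]" "[]" B "App s (Nom c)" "App t (Nom c)" c] assms(1,2)
    by (simp add: raw_close_fresh)
  from conv_Lam[OF this] show ?thesis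
    using conv_eta[OF assms(3)] conv_eta[OF assms(4)] by (blast intro: conv_trans conv_sym)
qed


subsection \<open>Algorithmic equality\<close>

inductive whr :: "'k raw \<Rightarrow> 'k raw \<Rightarrow> bool" where
  whr_beta: "whr (App (Lam A r) u) (inst 0 u r)"
| whr_App: "whr r r' \<Longrightarrow> whr (App r u) (App r' u)"

inductive_cases whr_AppE: "whr (App r u) v"
inductive_cases whr_LamE: "whr (Lam A r) v"

lemma whr_deterministic: "whr r p \<Longrightarrow> whr r q \<Longrightarrow> p = q"
proof (induction arbitrary: q rule: whr.induct)
  case (whr_beta A r u)
  then show ?case by (rule whr_AppE) (auto elim: whr_LamE)
next
  case (whr_App r r' u)
  from whr_App.prems show ?case
    by (rule whr_AppE) (use whr_App in \<open>blast elim: whr_LamE\<close>)+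
qed

lemma whr_normal_form_unique:
  assumes "whr\<^sup>*\<^sup>* s p" "whr\<^sup>*\<^sup>* s q" "\<And>v. \<not> whr p v" "\<And>v. \<not> whr q v"
  shows "p = q"
  using assms by (induction rule: converse_rtranclp_induct)
    (metis converse_rtranclpE, metis converse_rtranclpE whr_deterministic)

lemma noms_whr: "whr r r' \<Longrightarrow> noms r' \<subseteq> noms r"
  by (induction rule: whr.induct) (use noms_inst in fastforce)+

lemma noms_whr_rtrancl: "whr\<^sup>*\<^sup>* r r' \<Longrightarrow> noms r' \<subseteq> noms r"
  by (induction rule: rtranclp_induct) (auto dest: noms_whr)

lemma whr_conv: "whr r r' \<Longrightarrow> tyof \<Gamma> r = Some A \<Longrightarrow> conv \<Gamma> A r r'"
  by (induction arbitrary: A rule: whr.induct) (auto intro: conv.conv_beta conv_App conv_refl)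

lemma whr_rtrancl_conv: "whr\<^sup>*\<^sup>* r r' \<Longrightarrow> tyof \<Gamma> r = Some A \<Longrightarrow> conv \<Gamma> A r r'"
proof (induction rule: rtranclp_induct)
  case base
  then show ?case by (rule conv_refl)
next
  case (step p q)
  then show ?case using whr_conv conv_tyof conv_trans by metis
qed

inductive alg_eq :: "ty \<Rightarrow> 'k::signature raw \<Rightarrow> 'k raw \<Rightarrow> bool"
  and neutral_eq :: "ty \<Rightarrow> 'k raw \<Rightarrow> 'k raw \<Rightarrow> bool" where
  alg_Base: "whr\<^sup>*\<^sup>* s p \<Longrightarrow> whr\<^sup>*\<^sup>* t q \<Longrightarrow> neutral_eq (Base i) p q \<Longrightarrow> alg_eq (Base i) s t"
| alg_Fun: "(\<And>c. nty c = A \<Longrightarrow> alg_eq B (App s (Nom c)) (App t (Nom c))) \<Longrightarrow> alg_eq (Fun A B) s t"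
| neutral_Free: "neutral_eq (vty x) (Free x) (Free x)"
| neutral_Nom: "neutral_eq (nty c) (Nom c) (Nom c)"
| neutral_Cst: "const_ty k = Some A \<Longrightarrow> neutral_eq A (Cst k) (Cst k)"
| neutral_App: "neutral_eq (Fun A B) p q \<Longrightarrow> alg_eq A u v \<Longrightarrow> neutral_eq B (App p u) (App q v)"

inductive_cases alg_BaseE: "alg_eq (Base i) s t"
inductive_cases alg_FunE: "alg_eq (Fun A B) s t"
inductive_cases neutral_FreeE: "neutral_eq A (Free x) t"
inductive_cases neutral_NomE: "neutral_eq A (Nom c) t"
inductive_cases neutral_CstE: "neutral_eq A (Cst k) t"
inductive_cases neutral_AppE: "neutral_eq A (App p u) t"
inductive_cases neutral_LamE: "neutral_eq A (Lam B r) t"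

lemma alg_neutral_sym:
  "alg_eq A s t \<Longrightarrow> alg_eq A t s"
  "neutral_eq A s t \<Longrightarrow> neutral_eq A t s"
  by (induction rule: alg_eq_neutral_eq.inducts) (auto intro: alg_eq_neutral_eq.intros)

lemma neutral_whr_normal: "neutral_eq A p q \<Longrightarrow> \<not> whr p v"
proof (induction p arbitrary: A q v)
  case (App p u)
  then show ?case by (metis neutral_AppE neutral_LamE whr_AppE)
qed (auto elim: whr.cases)

lemma alg_neutral_trans:
  "alg_eq A s t \<Longrightarrow> alg_eq A t u \<Longrightarrow> alg_eq A s u"
  "neutral_eq A s t \<Longrightarrow> neutral_eq A' t u \<Longrightarrow> A' = A \<and> neutral_eq A s u"
proof (induction arbitrary: u and A' u rule: alg_eq_neutral_eq.inducts)
  case (alg_Base s p t q i)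
  from alg_Base.prems obtain q' r where
    t: "whr\<^sup>*\<^sup>* t q'" and u: "whr\<^sup>*\<^sup>* u r" and q': "neutral_eq (Base i) q' r" by (rule alg_BaseE)
  have "q' = q"
    using whr_normal_form_unique[OF t alg_Base.hyps(2)] neutral_whr_normal[OF q']
      neutral_whr_normal[OF alg_neutral_sym(2)[OF alg_Base.hyps(3)]] by blast
  with u q' alg_Base show ?case by (blast intro: alg_eq_neutral_eq.alg_Base)
next
  case (alg_Fun A B s t)
  then show ?case by (blast intro: alg_eq_neutral_eq.alg_Fun elim: alg_FunE)
next
  case (neutral_App A B p q u v A' w)
  from neutral_App.prems obtain C q' v' where
    w: "w = App q' v'" and q': "neutral_eq (Fun C A') q q'" and v': "alg_eq C v v'"
    by (rule neutral_AppE)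
  from neutral_App.IH(1)[OF q'] have "A' = B" "C = A" "neutral_eq (Fun A B) p q'" by auto
  with w v' neutral_App.IH(2) show ?case by (blast intro: alg_eq_neutral_eq.neutral_App)
qed (auto elim: neutral_FreeE neutral_NomE neutral_CstE intro: alg_eq_neutral_eq.intros)


subsection \<open>Completeness of algorithmic equality\<close>

primrec log_rel :: "ty \<Rightarrow> 'k::signature raw \<Rightarrow> 'k raw \<Rightarrow> bool" where
  "log_rel (Base i) s t \<longleftrightarrow> alg_eq (Base i) s t"
| "log_rel (Fun A B) s t \<longleftrightarrow>
    (\<forall>u v. tyof [] u = Some A \<longrightarrow> tyof [] v = Some A \<longrightarrow> log_rel A u v \<longrightarrow>
      log_rel B (App s u) (App t v))"

lemma log_rel_sym: "log_rel A s t \<Longrightarrow> log_rel A t s"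
  by (induction A arbitrary: s t) (auto intro: alg_neutral_sym)

lemma log_rel_trans: "log_rel A s t \<Longrightarrow> log_rel A t u \<Longrightarrow> log_rel A s u"
proof (induction A arbitrary: s t u)
  case (Base i)
  then show ?case by (auto intro: alg_neutral_trans)
next
  case (Fun A B)
  have "log_rel B (App s a) (App u b)"
    if ab: "tyof [] a = Some A" "tyof [] b = Some A" "log_rel A a b" for a b
  proof -
    have "log_rel A b b" using Fun.IH(1)[OF log_rel_sym[OF ab(3)] ab(3)] .
    then have "log_rel B (App s a) (App t b)" "log_rel B (App t b) (App u b)"
      using Fun.prems ab by auto
    then show ?thesis by (rule Fun.IH(2))
  qed
  then show ?case by simp
qed

lemma log_rel_whr_left: "whr s s' \<Longrightarrow> log_rel A s' t \<Longrightarrow> log_rel A s t"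
proof (induction A arbitrary: s s' t)
  case (Base i)
  then show ?case
    by (auto elim!: alg_BaseE intro: alg_Base converse_rtranclp_into_rtranclp)
next
  case (Fun A B)
  show ?case
    using Fun.prems(2) Fun.IH(2)[OF whr_App[OF Fun.prems(1)]] by auto
qed

lemma log_rel_whr: "whr s s' \<Longrightarrow> whr t t' \<Longrightarrow> log_rel A s' t' \<Longrightarrow> log_rel A s t"
  using log_rel_whr_left log_rel_sym by blast

lemma log_rel_reflect_reify:
  fixes p q s t :: "'k::signature raw"
  shows "(neutral_eq A p q \<longrightarrow> log_rel A p q) \<and> (log_rel A s t \<longrightarrow> alg_eq A s t)"
proof (induction A arbitrary: p q s t)
  case (Base i)
  then show ?case by (auto intro: alg_Base)
next
  case (Fun A B)
  have "log_rel A (Nom c :: 'k raw) (Nom c)" if "nty c = A" for c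
    using Fun.IH(1) that by (blast intro: neutral_Nom)
  then have "alg_eq (Fun A B) s t" if "log_rel (Fun A B) s t"
    using that Fun.IH(2) by (intro alg_Fun) simp
  moreover have "log_rel (Fun A B) p q" if "neutral_eq (Fun A B) p q"
    using that Fun.IH by (simp, blast intro: neutral_App)
  ultimately show ?case by blast
qed

lemmas log_rel_neutral = log_rel_reflect_reify[THEN conjunct1, rule_format]
lemmas log_rel_reify = log_rel_reflect_reify[THEN conjunct2, rule_format]

text \<open>Each of the terms \<open>us\<close> is closed, so \<open>u\<^sub>0, u\<^sub>1, \<dots>\<close> may be substituted one after another.\<close>

abbreviation insts :: "nat \<Rightarrow> 'k raw list \<Rightarrow> 'k raw \<Rightarrow> 'k raw" where
  "insts k us \<equiv> fold (inst k) us"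

abbreviation closed_list :: "ty list \<Rightarrow> 'k::signature raw list \<Rightarrow> bool" where
  "closed_list \<equiv> list_all2 (\<lambda>A u. tyof [] u = Some A)"

lemma tyof_insts:
  "closed_list \<Gamma> us \<Longrightarrow> tyof \<Gamma> r = Some A \<Longrightarrow> tyof [] (insts 0 us r) = Some A"
proof (induction arbitrary: r rule: list_all2_induct)
  case (Cons B \<Gamma> u us)
  then show ?case
    using tyof_inst[of "[]" B \<Gamma> r A u] tyof_closed[OF Cons.hyps(1)] by auto
qed simp

lemma insts_closed: "tyof [] r = Some A \<Longrightarrow> insts k us r = r"
  by (induction us) (auto simp: inst_closed)

lemma insts_App [simp]: "insts k us (App r u) = App (insts k us r) (insts k us u)"
  by (induction us arbitrary: r u) auto

lemma insts_Lam: "closed_list \<Gamma> us \<Longrightarrow> insts k us (Lam A r) = Lam A (insts (Suc k) us r)"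
  by (induction arbitrary: r rule: list_all2_induct) (auto simp: lift_closed)

lemma insts_inst:
  "closed_list \<Gamma> us \<Longrightarrow> insts k us (inst 0 u r) = inst 0 (insts k us u) (insts (Suc k) us r)"
  by (induction arbitrary: r u rule: list_all2_induct) (auto simp: inst_inst)

lemma whr_insts_beta:
  "closed_list \<Gamma> us \<Longrightarrow> whr (insts 0 us (App (Lam A r) u)) (insts 0 us (inst 0 u r))"
  by (simp add: insts_Lam insts_inst whr_beta)

inductive log_rel_list :: "ty list \<Rightarrow> 'k::signature raw list \<Rightarrow> 'k raw list \<Rightarrow> bool" where
  log_rel_Nil: "log_rel_list [] [] []"
| log_rel_Cons: "tyof [] u = Some A \<Longrightarrow> tyof [] v = Some A \<Longrightarrow> log_rel A u v \<Longrightarrow>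
    log_rel_list \<Gamma> us vs \<Longrightarrow> log_rel_list (A # \<Gamma>) (u # us) (v # vs)"

lemma log_rel_list_sym: "log_rel_list \<Gamma> us vs \<Longrightarrow> log_rel_list \<Gamma> vs us"
  by (induction rule: log_rel_list.induct) (auto intro: log_rel_list.intros log_rel_sym)

lemma log_rel_list_refl: "log_rel_list \<Gamma> us vs \<Longrightarrow> log_rel_list \<Gamma> vs vs"
  by (induction rule: log_rel_list.induct)
    (auto intro: log_rel_list.intros log_rel_trans log_rel_sym)

lemma log_rel_list_closed:
  assumes "log_rel_list \<Gamma> us vs"
  shows "closed_list \<Gamma> us" "closed_list \<Gamma> vs"
  using assms by (induction rule: log_rel_list.induct) auto

lemma log_rel_list_Bnd:
  "log_rel_list \<Gamma> us vs \<Longrightarrow> i < length \<Gamma> \<Longrightarrow>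
   log_rel (\<Gamma> ! i) (insts 0 us (Bnd i)) (insts 0 vs (Bnd i))"
proof (induction arbitrary: i rule: log_rel_list.induct)
  case (log_rel_Cons u A v \<Gamma> us vs)
  then show ?case by (cases i) (auto simp: insts_closed)
qed simp

lemma log_rel_Lam:
  assumes us: "log_rel_list \<Gamma> us vs"
    and body: "\<And>us vs. log_rel_list (A # \<Gamma>) us vs \<Longrightarrow> log_rel B (insts 0 us r) (insts 0 vs r')"
  shows "log_rel (Fun A B) (insts 0 us (Lam A r)) (insts 0 vs (Lam A r'))"
proof -
  have "log_rel B (App (insts 0 us (Lam A r)) u) (App (insts 0 vs (Lam A r')) v)"
    if u: "tyof [] u = Some A" and v: "tyof [] v = Some A" and uv: "log_rel A u v" for u v
  proof (rule log_rel_whr)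
    show "whr (App (insts 0 us (Lam A r)) u) (insts 0 us (inst 0 u r))"
      using whr_insts_beta[OF log_rel_list_closed(1)[OF us], of A r u] by (simp add: insts_closed[OF u])
    show "whr (App (insts 0 vs (Lam A r')) v) (insts 0 vs (inst 0 v r'))"
      using whr_insts_beta[OF log_rel_list_closed(2)[OF us], of A r' v] by (simp add: insts_closed[OF v])
    show "log_rel B (insts 0 us (inst 0 u r)) (insts 0 vs (inst 0 v r'))"
      using body[OF log_rel_Cons[OF u v uv us]] by simp
  qed
  then show ?thesis by simp
qed

lemma log_rel_tyof:
  "tyof \<Gamma> r = Some A \<Longrightarrow> log_rel_list \<Gamma> us vs \<Longrightarrow> log_rel A (insts 0 us r) (insts 0 vs r)"
proof (induction arbitrary: us vs rule: tyof_induct)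
  case (Bnd \<Gamma> i)
  then show ?case by (intro log_rel_list_Bnd)
next
  case (App \<Gamma> r u A B)
  note closed = log_rel_list_closed[OF App.prems]
  from App.IH(1,2)[OF App.prems] tyof_insts[OF closed(1) App.hyps(2)]
    tyof_insts[OF closed(2) App.hyps(2)]
  show ?case by simp
next
  case (Lam \<Gamma> A r B)
  then show ?case by (intro log_rel_Lam)
qed (auto simp: insts_closed intro: log_rel_neutral neutral_Free neutral_Nom neutral_Cst)

lemma log_rel_conv:
  "conv \<Gamma> A r r' \<Longrightarrow> log_rel_list \<Gamma> us vs \<Longrightarrow> log_rel A (insts 0 us r) (insts 0 vs r')"
proof (induction arbitrary: us vs rule: conv.induct)
  case (conv_refl \<Gamma> r A)
  then show ?case by (rule log_rel_tyof)
next
  case (conv_sym \<Gamma> A r r')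
  then show ?case by (blast intro: log_rel_sym log_rel_list_sym)
next
  case (conv_trans \<Gamma> A r r' r'')
  then show ?case by (blast intro: log_rel_trans log_rel_list_refl)
next
  case (conv_App \<Gamma> A B r r' u u')
  note closed = log_rel_list_closed[OF conv_App.prems]
  from conv_App.IH[OF conv_App.prems] conv_tyof[OF conv_App.hyps(2)]
    tyof_insts[OF closed(1), of u A] tyof_insts[OF closed(2), of u' A]
  show ?case by simp
next
  case (conv_Lam A \<Gamma> B r r')
  then show ?case by (intro log_rel_Lam)
next
  case (conv_beta A \<Gamma> r B u)
  have "tyof \<Gamma> (inst 0 u r) = Some B" using tyof_inst[of "[]" A \<Gamma> r B u] conv_beta.hyps by simp
  from log_rel_tyof[OF this conv_beta.prems] show ?case
    by (rule log_rel_whr_left[OF whr_insts_beta[OF log_rel_list_closed(1)[OF conv_beta.prems]]])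
next
  case (conv_eta \<Gamma> r A B)
  have "whr (App (insts 0 us (Lam A (App (lift 0 r) (Bnd 0)))) u) (App (insts 0 us r) u)"
    if "tyof [] u = Some A" for u
    using whr_insts_beta[OF log_rel_list_closed(1)[OF conv_eta.prems], of A "App (lift 0 r) (Bnd 0)" u]
    by (simp add: insts_closed[OF that] inst_lift_cancel)
  moreover have "log_rel (Fun A B) (insts 0 us r) (insts 0 vs r)"
    by (rule log_rel_tyof[OF conv_eta.hyps conv_eta.prems])
  ultimately show ?case by (auto intro: log_rel_whr_left simp del: insts_App)
qed

lemma conv_imp_alg_eq: "conv [] A r r' \<Longrightarrow> alg_eq A r r'"
  using log_rel_conv[OF _ log_rel_Nil] by (auto intro: log_rel_reify)


subsection \<open>Type-preserving renamings and permutations of nominal constants\<close>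

definition renaming :: "(nom \<Rightarrow> nom) \<Rightarrow> bool" where
  "renaming \<delta> \<longleftrightarrow> (\<forall>c. nty (\<delta> c) = nty c)"

lemma renaming_nty [simp]: "renaming \<delta> \<Longrightarrow> nty (\<delta> c) = nty c"
  by (simp add: renaming_def)

lemma renaming_id [simp]: "renaming id"
  by (simp add: renaming_def)

lemma renaming_comp [simp]: "renaming \<delta> \<Longrightarrow> renaming \<delta>' \<Longrightarrow> renaming (\<delta> \<circ> \<delta>')"
  by (simp add: renaming_def)

lemma is_perm_renaming [simp]: "is_perm \<pi> \<Longrightarrow> renaming \<pi>"
  by (simp add: renaming_def is_perm_def)

lemma is_perm_inj: "is_perm \<pi> \<Longrightarrow> inj \<pi>"
  by (simp add: is_perm_def bij_is_inj)

lemma is_perm_eq_iff [simp]: "is_perm \<pi> \<Longrightarrow> \<pi> a = \<pi> b \<longleftrightarrow> a = b"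
  by (simp add: is_perm_inj inj_eq)

lemma is_perm_id [simp]: "is_perm id"
  by (simp add: is_perm_def)

lemma is_perm_comp [simp]:
  assumes "is_perm \<pi>" "is_perm \<pi>'"
  shows "is_perm (\<pi> \<circ> \<pi>')"
proof -
  have "{c. (\<pi> \<circ> \<pi>') c \<noteq> c} \<subseteq> {c. \<pi>' c \<noteq> c} \<union> {c. \<pi> c \<noteq> c}" by auto
  then have "finite {c. (\<pi> \<circ> \<pi>') c \<noteq> c}"
    using assms by (auto simp: is_perm_def intro: finite_subset)
  then show ?thesis using assms by (simp add: is_perm_def bij_comp)
qed

lemma is_perm_inv_apply [simp]:
  assumes "is_perm \<pi>"
  shows "inv \<pi> (\<pi> c) = c" "\<pi> (inv \<pi> c) = c"
  using assms by (simp_all add: is_perm_def bij_is_inj bij_is_surj surj_f_inv_f)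

lemma is_perm_inv [simp]:
  assumes "is_perm \<pi>"
  shows "is_perm (inv \<pi>)"
proof -
  have "{c. inv \<pi> c \<noteq> c} = {c. \<pi> c \<noteq> c}" using is_perm_inv_apply[OF assms] by metis
  moreover have "nty (inv \<pi> c) = nty c" for c
    using assms renaming_nty[of \<pi> "inv \<pi> c"] by simp
  ultimately show ?thesis using assms by (simp add: is_perm_def bij_imp_bij_inv)
qed

lemma is_perm_transpose:
  assumes "nty a = nty b"
  shows "is_perm (transpose a b)"
proof -
  have "{c. transpose a b c \<noteq> c} \<subseteq> {a, b}" by (auto simp: transpose_def)
  then have "finite {c. transpose a b c \<noteq> c}" by (rule finite_subset) simp
  with assms show ?thesis by (simp add: is_perm_def transpose_def)
qed

lemma is_perm_extends_inj_on:
  assumes "finite X" "inj_on f X" "\<And>c. c \<in> X \<Longrightarrow> nty (f c) = nty c"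
  shows "\<exists>\<pi>. is_perm \<pi> \<and> (\<forall>c\<in>X. \<pi> c = f c)"
  using assms
proof (induction X)
  case empty
  then show ?case using is_perm_id by blast
next
  case (insert a X)
  then obtain \<pi> where \<pi>: "is_perm \<pi>" "\<And>c. c \<in> X \<Longrightarrow> \<pi> c = f c" by auto
  let ?\<pi> = "transpose (\<pi> a) (f a) \<circ> \<pi>"
  have "?\<pi> c = f c" if "c \<in> X" for c
  proof -
    have "c \<noteq> a" "f c \<noteq> f a" using that insert.hyps insert.prems(1) by (auto simp: inj_on_def)
    then show ?thesis using \<pi> that by (metis comp_apply is_perm_eq_iff transpose_apply_other)
  qed
  moreover have "is_perm ?\<pi>"
    using insert.prems(2) \<pi>(1) by (intro is_perm_comp is_perm_transpose) auto
  ultimately have "is_perm ?\<pi> \<and> (\<forall>c \<in> insert a X. ?\<pi> c = f c)" by simp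
  then show ?case by (rule exI[of _ ?\<pi>])
qed

lemma is_perm_extends_fixing:
  assumes "finite X" "finite K" "inj_on f X" "\<And>c. c \<in> X \<Longrightarrow> nty (f c) = nty c"
    and "X \<inter> K = {}" "f ` X \<inter> K = {}"
  shows "\<exists>\<pi>. is_perm \<pi> \<and> (\<forall>c\<in>X. \<pi> c = f c) \<and> (\<forall>c\<in>K. \<pi> c = c)"
proof -
  let ?f = "\<lambda>c. if c \<in> K then c else f c"
  have "inj_on ?f (X \<union> K)"
    using assms(3,5,6) by (auto simp: inj_on_def)
  then have "\<exists>\<pi>. is_perm \<pi> \<and> (\<forall>c \<in> X \<union> K. \<pi> c = ?f c)"
    using assms(1,2,4) by (intro is_perm_extends_inj_on) auto
  then show ?thesis using assms(5) by (metis UnCI disjoint_iff)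
qed

lemma fresh_family:
  fixes mk :: "nat \<Rightarrow> ty \<Rightarrow> 'b"
  assumes "finite Y" and mk_inject: "\<And>m n A B. mk m A = mk n B \<longleftrightarrow> m = n \<and> A = B"
  obtains f :: "nom \<Rightarrow> 'b" where "inj f" "range f \<inter> Y = {}" "\<And>c. \<exists>n. f c = mk n (nty c)"
proof -
  have "inj (case_prod mk)" by (auto intro!: injI simp: mk_inject)
  then have "finite (fst ` (case_prod mk -` Y))" using assms(1) by (simp add: finite_vimageI)
  then obtain m where "\<forall>p \<in> case_prod mk -` Y. fst p < m"
    by (auto simp: finite_nat_set_iff_bounded)
  then have m: "n < m" if "mk n A \<in> Y" for n A
    using that by (metis case_prod_conv fst_conv vimage_eq)
  define f where "f c = (case c of N n A \<Rightarrow> mk (m + n) A)" for c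
  show ?thesis
  proof
    show "inj f" by (rule injI) (auto simp: f_def mk_inject split: nom.splits)
    show "range f \<inter> Y = {}" using m by (force simp: f_def split: nom.splits)
    show "\<exists>n. f c = mk n (nty c)" for c by (auto simp: f_def split: nom.split)
  qed
qed

lemma fresh_noms:
  assumes "finite Y"
  obtains f where "inj f" "renaming f" "range f \<inter> Y = {}"
  using fresh_family[OF assms, of N] by (metis nom.inject nom.sel(2) renaming_def)

lemma fresh_vars:
  assumes "finite Y"
  obtains z :: "nom \<Rightarrow> var" where "inj z" "\<And>c. vty (z c) = nty c" "range z \<inter> Y = {}"
  using fresh_family[OF assms, of V] by (metis var.inject var.sel(2))

lemma ex_fresh_nom: "finite X \<Longrightarrow> \<exists>c. nty c = A \<and> c \<notin> X"
  using fresh_noms[of X] by (metis disjoint_iff nom.sel(2) rangeI renaming_nty)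

lemma is_perm_avoiding_fixing:
  assumes "finite X" "finite K" "finite Y"
  obtains \<pi> where "is_perm \<pi>" "\<And>c. c \<in> K \<Longrightarrow> \<pi> c = c" "\<pi> ` (X - K) \<inter> Y = {}"
proof -
  obtain f where f: "inj f" "renaming f" "range f \<inter> (Y \<union> K) = {}"
    using fresh_noms[of "Y \<union> K"] assms(2,3) by blast
  have "\<exists>\<pi>. is_perm \<pi> \<and> (\<forall>c \<in> X - K. \<pi> c = f c) \<and> (\<forall>c\<in>K. \<pi> c = c)"
    using assms(1,2) f inj_on_subset[OF f(1)] by (intro is_perm_extends_fixing) auto
  then obtain \<pi> where \<pi>: "is_perm \<pi>" "\<And>c. c \<in> X - K \<Longrightarrow> \<pi> c = f c" "\<And>c. c \<in> K \<Longrightarrow> \<pi> c = c"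
    by blast
  have "\<pi> ` (X - K) \<subseteq> range f" using \<pi>(2) by auto
  then have "\<pi> ` (X - K) \<inter> Y = {}" using f(3) by blast
  with \<pi>(1,3) show ?thesis by (rule that)
qed

lemma is_perm_agreeing_avoiding:
  assumes \<pi>: "is_perm \<pi>" and "finite X" "finite K" "finite Y" "X \<inter> K = {}"
  obtains \<kappa> where "is_perm \<kappa>" "\<And>c. c \<in> K \<Longrightarrow> \<kappa> c = \<pi> c" "\<kappa> ` X \<inter> Y = {}"
proof -
  obtain \<mu> where \<mu>: "is_perm \<mu>" "\<And>c. c \<in> K \<Longrightarrow> \<mu> c = c" "\<mu> ` (X - K) \<inter> inv \<pi> ` Y = {}"
    by (rule is_perm_avoiding_fixing[OF assms(2,3) finite_imageI[OF assms(4)]]) blast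
  show ?thesis
  proof
    show "is_perm (\<pi> \<circ> \<mu>)" using \<pi> \<mu>(1) by simp
    show "(\<pi> \<circ> \<mu>) c = \<pi> c" if "c \<in> K" for c using \<mu>(2)[OF that] by simp
    have "\<mu> c \<notin> inv \<pi> ` Y" if "c \<in> X" for c using that \<mu>(3) assms(5) by blast
    then show "(\<pi> \<circ> \<mu>) ` X \<inter> Y = {}" using \<pi> by (force simp: image_iff)
  qed
qed

lemma is_perm_avoiding:
  assumes "finite X" "finite Y"
  obtains \<pi> where "is_perm \<pi>" "\<pi> ` X \<inter> Y = {}"
  using is_perm_avoiding_fixing[OF assms(1) finite.emptyI assms(2)] by (metis Diff_empty)

lemma is_perm_relating:
  assumes \<pi>: "is_perm \<pi>" "\<pi> ` X \<inter> Y = {}" and \<pi>': "is_perm \<pi>'" "\<pi>' ` X \<inter> Y = {}"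
    and "finite X" "finite Y"
  obtains \<mu> where "is_perm \<mu>" "\<And>c. c \<in> X \<Longrightarrow> \<mu> (\<pi> c) = \<pi>' c" "\<And>c. c \<in> Y \<Longrightarrow> \<mu> c = c"
proof -
  let ?f = "\<pi>' \<circ> inv \<pi>"
  have f: "is_perm ?f" using \<pi>(1) \<pi>'(1) by simp
  have "?f ` \<pi> ` X \<inter> Y = {}" using \<pi>(1) \<pi>'(2) by (simp add: image_image)
  then have "\<exists>\<mu>. is_perm \<mu> \<and> (\<forall>c \<in> \<pi> ` X. \<mu> c = ?f c) \<and> (\<forall>c\<in>Y. \<mu> c = c)"
    using assms renaming_nty[OF is_perm_renaming[OF f]]
    by (intro is_perm_extends_fixing) (auto simp: inj_on_def)
  then show ?thesis using that \<pi>(1) by auto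
qed


subsection \<open>Identifying nominal constants\<close>

lemma raw_perm_lift: "raw_perm \<delta> (lift k r) = lift k (raw_perm \<delta> r)"
  by (induction r arbitrary: k) auto

lemma raw_perm_inst: "raw_perm \<delta> (inst k w r) = inst k (raw_perm \<delta> w) (raw_perm \<delta> r)"
  by (induction r arbitrary: k w) (auto simp: raw_perm_lift)

lemma raw_perm_eq_App:
  "raw_perm \<delta> s = App p u \<longleftrightarrow> (\<exists>s1 s2. s = App s1 s2 \<and> p = raw_perm \<delta> s1 \<and> u = raw_perm \<delta> s2)"
  by (cases s) auto

lemma raw_perm_eq_Lam: "raw_perm \<delta> s = Lam A p \<longleftrightarrow> (\<exists>r. s = Lam A r \<and> p = raw_perm \<delta> r)"
  by (cases s) auto

lemma whr_raw_perm_reflect: "whr (raw_perm \<delta> s) q \<Longrightarrow> \<exists>s'. whr s s' \<and> q = raw_perm \<delta> s'"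
proof (induction "raw_perm \<delta> s" q arbitrary: s rule: whr.induct)
  case (whr_beta A r u)
  then obtain r' u' where "s = App (Lam A r') u'" "r = raw_perm \<delta> r'" "u = raw_perm \<delta> u'"
    by (metis raw_perm_eq_App raw_perm_eq_Lam)
  then show ?case by (metis raw_perm_inst whr.whr_beta)
next
  case (whr_App r r' u)
  then obtain s1 s2 where "s = App s1 s2" "r = raw_perm \<delta> s1" "u = raw_perm \<delta> s2"
    by (metis raw_perm_eq_App)
  then show ?case using whr_App.hyps(2) by (metis raw_perm.simps(5) whr.whr_App)
qed

lemma whr_rtrancl_raw_perm_reflect:
  "whr\<^sup>*\<^sup>* (raw_perm \<delta> s) q \<Longrightarrow> \<exists>s'. whr\<^sup>*\<^sup>* s s' \<and> q = raw_perm \<delta> s'"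
  by (induction rule: rtranclp_induct)
    (blast, metis rtranclp.rtrancl_into_rtrancl whr_raw_perm_reflect)

text \<open>
  Algorithmic equality never inspects which nominal constants are equal beyond matching the atoms
  of the two sides, so a computation on the identified term lifts to the original one as long as
  the other side mentions none of the identified constants.
\<close>

lemma alg_neutral_identify:
  assumes "finite {c. \<delta> c \<noteq> c}"
  shows
  "alg_eq A p t \<Longrightarrow> p = raw_perm \<delta> s \<Longrightarrow> tyof [] s = Some A \<Longrightarrow> tyof [] t = Some A \<Longrightarrow>
     \<forall>c. \<delta> c \<noteq> c \<longrightarrow> \<delta> c \<notin> noms t \<Longrightarrow> conv [] A s t"
  "neutral_eq A p t \<Longrightarrow> p = raw_perm \<delta> s \<Longrightarrow> tyof [] s \<noteq> None \<Longrightarrow> tyof [] t \<noteq> None \<Longrightarrow>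
     \<forall>c. \<delta> c \<noteq> c \<longrightarrow> \<delta> c \<notin> noms t \<Longrightarrow> conv [] A s t"
proof (induction A p t and A p t arbitrary: s and s rule: alg_eq_neutral_eq.inducts)
  case (alg_Base r p t q i)
  obtain s' where s': "whr\<^sup>*\<^sup>* s s'" "p = raw_perm \<delta> s'"
    using alg_Base.hyps(1) alg_Base.prems(1) whr_rtrancl_raw_perm_reflect by blast
  have s_conv: "conv [] (Base i) s s'" and t_conv: "conv [] (Base i) t q"
    using whr_rtrancl_conv s'(1) alg_Base by blast+
  have "conv [] (Base i) s' q"
    using conv_tyof[OF s_conv] conv_tyof[OF t_conv] noms_whr_rtrancl[OF alg_Base.hyps(2)]
      alg_Base.prems(4) by (intro alg_Base.IH[OF s'(2)]) auto
  with s_conv t_conv show ?case by (meson conv_sym conv_trans)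
next
  case (alg_Fun A B p t)
  let ?moved = "{c. \<delta> c \<noteq> c}"
  obtain c where c: "nty c = A" "c \<notin> noms s \<union> noms t \<union> ?moved \<union> \<delta> ` ?moved"
    using ex_fresh_nom[of "noms s \<union> noms t \<union> ?moved \<union> \<delta> ` ?moved"] assms by auto
  have "conv [] B (App s (Nom c)) (App t (Nom c))"
    using alg_Fun.prems c by (intro alg_Fun.IH[OF c(1)]) auto
  with c alg_Fun.prems show ?case by (auto intro: conv_ext)
next
  case (neutral_App A B p q u v)
  then obtain s1 s2 where s: "s = App s1 s2" "p = raw_perm \<delta> s1" "u = raw_perm \<delta> s2"
    by (metis raw_perm_eq_App)
  have fun_conv: "conv [] (Fun A B) s1 q"
    using neutral_App.prems s(1) by (intro neutral_App.IH(1)[OF s(2)]) auto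
  then have "conv [] A s2 v"
    using neutral_App.prems s(1) conv_tyof[OF fun_conv] by (intro neutral_App.IH(2)[OF s(3)]) auto
  with fun_conv s(1) show ?case by (auto intro: conv_App)
next
  case (neutral_Nom c)
  then show ?case by (cases s) (auto intro: conv_refl, metis conv_refl tyof.simps(3))
next
  case (neutral_Free x)
  then show ?case by (cases s) (auto intro: conv_refl)
next
  case (neutral_Cst k A)
  then show ?case by (cases s) (auto intro: conv_refl)
qed

lemma conv_identify:
  assumes "finite {c. \<delta> c \<noteq> c}" "conv [] A (raw_perm \<delta> s) t" "tyof [] s = Some A"
    and "\<And>c. \<delta> c \<noteq> c \<Longrightarrow> \<delta> c \<notin> noms t"
  shows "conv [] A s t"
  using alg_neutral_identify(1)[OF assms(1) conv_imp_alg_eq[OF assms(2)] refl assms(3)]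
    assms(4) conv_tyof[OF assms(2)] by blast


subsection \<open>Terms and their representatives\<close>

definition represents :: "'k::signature raw \<Rightarrow> 'k tm \<Rightarrow> bool" where
  "represents r t \<longleftrightarrow> tyof [] r = Some (tm_ty t) \<and> abs_tm r = t"

lemma represents_tyof: "represents r t \<Longrightarrow> tyof [] r = Some (tm_ty t)"
  by (simp add: represents_def)

lemma represents_unique: "represents r t \<Longrightarrow> represents r u \<Longrightarrow> t = u"
  by (simp add: represents_def)

lemma eqv_iff_abs_tm_eq: "eqv r r' \<longleftrightarrow> tyof [] r \<noteq> None \<and> tyof [] r' \<noteq> None \<and> abs_tm r = abs_tm r'"
proof -
  have "eqv r r \<longleftrightarrow> tyof [] r \<noteq> None" for r :: "'a raw"
    unfolding eqv_def using conv_refl conv_tyof by fastforce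
  then show ?thesis using Quotient3_rel[OF Quotient3_tm, of r r'] by simp
qed

lemma represents_rep [simp]: "represents (rep_tm t) t"
  using Quotient3_rep_reflp[OF Quotient3_tm, of t] Quotient3_abs_rep[OF Quotient3_tm, of t]
  by (auto simp: represents_def tm_ty_def eqv_iff_abs_tm_eq)

lemma tyof_rep_tm [simp]: "tyof [] (rep_tm t) = Some (tm_ty t)"
  by (simp add: represents_tyof)

lemma eqv_rep_tm_iff: "eqv (rep_tm t) r \<longleftrightarrow> represents r t"
  using represents_rep[of t] conv_tyof[of "[]" _ "rep_tm t" r]
  unfolding represents_def by (metis eqv_def eqv_iff_abs_tm_eq option.distinct(1))

lemma represents_conv:
  assumes "represents r t" "represents r' t"
  shows "conv [] (tm_ty t) r r'"
proof -
  obtain A where "conv [] A r r'"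
    using assms eqv_iff_abs_tm_eq[of r r'] by (auto simp: represents_def eqv_def)
  then show ?thesis using conv_tyof represents_tyof[OF assms(1)] by fastforce
qed

lemma conv_represents:
  assumes "conv [] A r r'" "represents r t"
  shows "represents r' t"
proof -
  have "eqv (rep_tm t) r" "eqv r r'" using assms unfolding eqv_rep_tm_iff by (auto simp: eqv_def)
  then show ?thesis by (simp add: eqv_iff_abs_tm_eq flip: eqv_rep_tm_iff)
qed

lemma represents_abs_tm: "tyof [] r = Some A \<Longrightarrow> represents r (abs_tm r)"
  unfolding eqv_rep_tm_iff[symmetric] eqv_iff_abs_tm_eq
  using represents_rep[of "abs_tm r"] by (simp add: represents_def)

lemma conv_represents_abs_tm: "conv [] A r r' \<Longrightarrow> represents r' (abs_tm r)"
  by (meson conv_represents conv_tyof represents_abs_tm)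

lemma represents_ty: "represents r t \<Longrightarrow> tyof [] r = Some A \<Longrightarrow> tm_ty t = A"
  by (simp add: represents_def)

definition tm_nom :: "nom \<Rightarrow> 'k::signature tm" where
  "tm_nom c = abs_tm (Nom c)"

definition tm_app :: "'k::signature tm \<Rightarrow> 'k tm \<Rightarrow> 'k tm" where
  "tm_app t u = abs_tm (App (rep_tm t) (rep_tm u))"

definition tm_map :: "(nom \<Rightarrow> 'k::signature tm) \<Rightarrow> 'k subst \<Rightarrow> 'k tm \<Rightarrow> 'k tm" where
  "tm_map f \<theta> t = abs_tm (raw_map (\<lambda>c. rep_tm (f c)) (\<lambda>x. rep_tm (\<theta> x)) (rep_tm t))"

definition tm_typed :: "(nom \<Rightarrow> 'k::signature tm) \<Rightarrow> 'k subst \<Rightarrow> bool" where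
  "tm_typed f \<theta> \<longleftrightarrow> (\<forall>c. tm_ty (f c) = nty c) \<and> (\<forall>x. tm_ty (\<theta> x) = vty x)"

lemma represents_nom: "represents (Nom c) (tm_nom c)"
  unfolding tm_nom_def by (rule represents_abs_tm) simp

lemma represents_var: "represents (Free x) (tm_var x)"
  unfolding tm_var_def by (rule represents_abs_tm) simp

lemma represents_app:
  assumes "represents r t" "represents v u" "tm_ty t = Fun (tm_ty u) B"
  shows "represents (App r v) (tm_app t u)"
  unfolding tm_app_def
  using represents_conv[OF represents_rep assms(1)] represents_conv[OF represents_rep assms(2)]
  by (intro conv_represents_abs_tm conv_App) (simp add: assms(3))

lemma raw_typed_represents:
  assumes "tm_typed f \<theta>" "\<And>c. represents (f' c) (f c)" "\<And>x. represents (\<theta>' x) (\<theta> x)"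
  shows "raw_typed f' \<theta>'"
  using assms by (simp add: raw_typed_def tm_typed_def represents_def)

lemma represents_map:
  assumes "tm_typed f \<theta>" "\<And>c. represents (f' c) (f c)" "\<And>x. represents (\<theta>' x) (\<theta> x)"
    and "represents r t"
  shows "represents (raw_map f' \<theta>' r) (tm_map f \<theta> t)"
  unfolding tm_map_def
proof (rule conv_represents_abs_tm[OF conv_trans])
  have conv: "conv [] (nty c) (rep_tm (f c)) (f' c)" "conv [] (vty x) (rep_tm (\<theta> x)) (\<theta>' x)" for c x
    using represents_conv[OF represents_rep] assms(1-3) by (metis tm_typed_def)+
  show "conv [] (tm_ty t) (raw_map (\<lambda>c. rep_tm (f c)) (\<lambda>x. rep_tm (\<theta> x)) (rep_tm t))
      (raw_map f' \<theta>' (rep_tm t))"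
    by (intro raw_map_conv_cong tyof_rep_tm conv)
  show "conv [] (tm_ty t) (raw_map f' \<theta>' (rep_tm t)) (raw_map f' \<theta>' r)"
    by (rule conv_raw_map[OF raw_typed_represents[OF assms(1-3)]
        represents_conv[OF represents_rep assms(4)]])
qed

lemma tm_ty_nom [simp]: "tm_ty (tm_nom c) = nty c"
  by (rule represents_ty[OF represents_nom]) simp

lemma tm_ty_var [simp]: "tm_ty (tm_var x) = vty x"
  by (rule represents_ty[OF represents_var]) simp

lemma tm_ty_app:
  assumes "tm_ty t = Fun (tm_ty u) B"
  shows "tm_ty (tm_app t u) = B"
  using assms by (intro represents_ty[OF represents_app[OF represents_rep represents_rep assms]]) simp

lemma tm_ty_map [simp]:
  assumes "tm_typed f \<theta>"
  shows "tm_ty (tm_map f \<theta> t) = tm_ty t"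
  by (intro represents_ty[OF represents_map[OF assms represents_rep represents_rep represents_rep]]
      tyof_raw_map raw_typed_represents[OF assms] represents_rep tyof_rep_tm)

lemma tm_map_nom [simp]: "tm_typed f \<theta> \<Longrightarrow> tm_map f \<theta> (tm_nom c) = f c"
  using represents_map[OF _ represents_rep represents_rep represents_nom]
  by (fastforce intro: represents_unique)

lemma tm_map_var [simp]: "tm_typed f \<theta> \<Longrightarrow> tm_map f \<theta> (tm_var x) = \<theta> x"
  using represents_map[OF _ represents_rep represents_rep represents_var]
  by (fastforce intro: represents_unique)

lemma tm_map_ident [simp]: "tm_map tm_nom tm_var t = t"
  using represents_map[OF _ represents_nom represents_var represents_rep]
  by (fastforce simp: tm_typed_def intro: represents_unique)

lemma tm_map_app:
  assumes "tm_typed f \<theta>" "tm_ty t = Fun (tm_ty u) B"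
  shows "tm_map f \<theta> (tm_app t u) = tm_app (tm_map f \<theta> t) (tm_map f \<theta> u)"
proof (rule represents_unique)
  let ?m = "raw_map (\<lambda>c. rep_tm (f c)) (\<lambda>x. rep_tm (\<theta> x))"
  note map = represents_map[OF assms(1) represents_rep represents_rep]
  show "represents (?m (App (rep_tm t) (rep_tm u))) (tm_map f \<theta> (tm_app t u))"
    using assms(2) by (intro map represents_app represents_rep)
  show "represents (?m (App (rep_tm t) (rep_tm u))) (tm_app (tm_map f \<theta> t) (tm_map f \<theta> u))"
    using assms represents_app[OF map[OF represents_rep] map[OF represents_rep]] by simp
qed

lemma tm_typed_map:
  "tm_typed f \<theta> \<Longrightarrow> tm_typed g \<eta> \<Longrightarrow> tm_typed (\<lambda>c. tm_map f \<theta> (g c)) (\<lambda>x. tm_map f \<theta> (\<eta> x))"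
  using tm_ty_map[of f \<theta>] by (simp add: tm_typed_def)

lemma tm_map_map:
  assumes "tm_typed f \<theta>" "tm_typed g \<eta>"
  shows "tm_map f \<theta> (tm_map g \<eta> t) = tm_map (\<lambda>c. tm_map f \<theta> (g c)) (\<lambda>x. tm_map f \<theta> (\<eta> x)) t"
proof (rule represents_unique)
  let ?m = "raw_map (\<lambda>c. rep_tm (f c)) (\<lambda>x. rep_tm (\<theta> x))"
  let ?n = "raw_map (\<lambda>c. rep_tm (g c)) (\<lambda>x. rep_tm (\<eta> x))"
  note map = represents_map[OF _ represents_rep represents_rep]
  show "represents (?m (?n (rep_tm t))) (tm_map f \<theta> (tm_map g \<eta> t))"
    by (intro map assms represents_rep)
  show "represents (?m (?n (rep_tm t)))
      (tm_map (\<lambda>c. tm_map f \<theta> (g c)) (\<lambda>x. tm_map f \<theta> (\<eta> x)) t)"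
    unfolding raw_map_raw_map
    by (intro represents_map[OF tm_typed_map] map assms represents_rep)
qed


subsection \<open>Support and free variables\<close>

lemma supp_subset_noms: "represents r t \<Longrightarrow> supp t \<subseteq> noms r"
  by (auto simp: supp_def eqv_rep_tm_iff)

text \<open>
  If some representative avoids an atom, then erasing the atom from any other one stays in the
  same class. This gives representatives without vacuous atoms and does not need normal forms.
\<close>

lemma represented_without_vacuous_atoms:
  fixes atoms :: "'k::signature raw \<Rightarrow> 'b set" and t :: "'k tm"
  assumes finite: "\<And>r. finite (atoms r)"
    and erase: "\<And>a. \<exists>f \<theta>. raw_typed f \<theta> \<and>
      (\<forall>r. atoms (raw_map f \<theta> r) = atoms r - {a} \<and> (a \<notin> atoms r \<longrightarrow> raw_map f \<theta> r = r))"
  shows "\<exists>r. represents r t \<and> atoms r \<subseteq> (\<Inter>r \<in> {r. eqv (rep_tm t) r}. atoms r)"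
proof -
  obtain r where r: "represents r t"
    and minimal: "\<And>q. represents q t \<Longrightarrow> card (atoms r) \<le> card (atoms q)"
    using arg_min_nat_lemma[of "\<lambda>r. represents r t" "rep_tm t" "card \<circ> atoms"] by auto
  have "a \<in> atoms q" if a: "a \<in> atoms r" and q: "represents q t" for a q
  proof (rule ccontr)
    assume "a \<notin> atoms q"
    with erase[of a] obtain f \<theta> where typed: "raw_typed f \<theta>"
      and erased: "atoms (raw_map f \<theta> r) = atoms r - {a}" and fixed: "raw_map f \<theta> q = q" by blast
    have "conv [] (tm_ty t) (raw_map f \<theta> q) (raw_map f \<theta> r)"
      by (rule conv_raw_map[OF typed represents_conv[OF q r]])
    then have "represents (raw_map f \<theta> r) t" using conv_represents q fixed by simp
    then show False using minimal[of "raw_map f \<theta> r"] card_Diff1_less[OF finite a] erased by simp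
  qed
  then show ?thesis using r by (auto simp: eqv_rep_tm_iff)
qed

lemma represented_by_supp: obtains r where "represents r t" "noms r = supp t"
proof -
  have "\<exists>f \<theta>. raw_typed f \<theta> \<and> (\<forall>r :: 'a raw. noms (raw_map f \<theta> r) = noms r - {c} \<and>
      (c \<notin> noms r \<longrightarrow> raw_map f \<theta> r = r))" for c
  proof (intro exI conjI allI impI)
    let ?f = "Nom(c := Free (V 0 (nty c))) :: nom \<Rightarrow> 'a raw"
    show "raw_typed ?f Free" by (simp add: raw_typed_def)
    show "noms (raw_map ?f Free r) = noms r - {c}" for r
      by (auto simp: noms_raw_map split: if_splits)
    show "raw_map ?f Free r = r" if "c \<notin> noms r" for r
      using that raw_map_cong[of r ?f Nom Free Free] by (metis fun_upd_other raw_map_ident)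
  qed
  from represented_without_vacuous_atoms[of noms, OF finite_noms this] show ?thesis
    using that supp_subset_noms by (fastforce simp: supp_def)
qed

lemma represented_by_fv: obtains r where "represents r t" "frees r \<subseteq> fv t"
proof -
  have "\<exists>f \<theta>. raw_typed f \<theta> \<and> (\<forall>r :: 'a raw. frees (raw_map f \<theta> r) = frees r - {x} \<and>
      (x \<notin> frees r \<longrightarrow> raw_map f \<theta> r = r))" for x
  proof (intro exI conjI allI impI)
    let ?\<theta> = "Free(x := Nom (N 0 (vty x))) :: var \<Rightarrow> 'a raw"
    show "raw_typed Nom ?\<theta>" by (simp add: raw_typed_def)
    show "frees (raw_map Nom ?\<theta> r) = frees r - {x}" for r
      by (auto simp: frees_raw_map split: if_splits)
    show "raw_map Nom ?\<theta> r = r" if "x \<notin> frees r" for r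
      using that raw_map_cong[of r Nom Nom ?\<theta> Free] by (metis fun_upd_other raw_map_ident)
  qed
  from represented_without_vacuous_atoms[of frees, OF finite_frees this] show ?thesis
    using that by (auto simp: fv_def)
qed

lemma finite_supp [simp]: "finite (supp t)"
  using represented_by_supp finite_noms by metis

lemma finite_fv [simp]: "finite (fv t)"
proof -
  have "fv t \<subseteq> frees (rep_tm t)" by (auto simp: fv_def eqv_rep_tm_iff)
  then show ?thesis using finite_frees finite_subset by blast
qed

lemma supp_nom: "supp (tm_nom c) \<subseteq> {c}"
  using supp_subset_noms[OF represents_nom] by simp

lemma supp_var [simp]: "supp (tm_var x) = {}"
  using supp_subset_noms[OF represents_var] by simp

lemma supp_app:
  assumes "tm_ty t = Fun (tm_ty u) B"
  shows "supp (tm_app t u) \<subseteq> supp t \<union> supp u"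
proof -
  obtain r where r: "represents r t" "noms r = supp t" by (rule represented_by_supp)
  obtain v where v: "represents v u" "noms v = supp u" by (rule represented_by_supp)
  show ?thesis using supp_subset_noms[OF represents_app[OF r(1) v(1) assms]] r(2) v(2) by simp
qed

lemma supp_map:
  assumes "tm_typed f \<theta>"
  shows "supp (tm_map f \<theta> t) \<subseteq> (\<Union>c\<in>supp t. supp (f c)) \<union> (\<Union>x. supp (\<theta> x))"
proof -
  have "\<exists>r. represents r t \<and> noms r = supp t" for t :: "'a tm"
    using represented_by_supp by metis
  then obtain R :: "'a tm \<Rightarrow> 'a raw" where R: "\<And>t. represents (R t) t" "\<And>t. noms (R t) = supp t"
    by metis
  from supp_subset_noms[OF represents_map[OF assms R(1) R(1) R(1)]] show ?thesis
    by (fastforce simp: noms_raw_map R(2))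
qed

lemma tm_map_cong:
  assumes "tm_typed f \<theta>" "tm_typed f' \<theta>'"
    and "\<And>c. c \<in> supp t \<Longrightarrow> f c = f' c" and "\<And>x. x \<in> fv t \<Longrightarrow> \<theta> x = \<theta>' x"
  shows "tm_map f \<theta> t = tm_map f' \<theta>' t"
proof -
  have mixed: "tm_typed f' \<theta>" using assms(1,2) by (simp add: tm_typed_def)
  note map = represents_map[OF _ represents_rep represents_rep]
  obtain r where r: "represents r t" "noms r = supp t" by (rule represented_by_supp)
  have "raw_map (\<lambda>c. rep_tm (f c)) (\<lambda>x. rep_tm (\<theta> x)) r =
      raw_map (\<lambda>c. rep_tm (f' c)) (\<lambda>x. rep_tm (\<theta> x)) r"
    using r(2) assms(3) by (intro raw_map_cong) auto
  then have "tm_map f \<theta> t = tm_map f' \<theta> t"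
    using map[OF assms(1) r(1)] map[OF mixed r(1)] by (auto intro: represents_unique)
  obtain q where q: "represents q t" "frees q \<subseteq> fv t" by (rule represented_by_fv)
  have "raw_map (\<lambda>c. rep_tm (f' c)) (\<lambda>x. rep_tm (\<theta> x)) q =
      raw_map (\<lambda>c. rep_tm (f' c)) (\<lambda>x. rep_tm (\<theta>' x)) q"
    using q(2) assms(4) by (intro raw_map_cong) auto
  then have "tm_map f' \<theta> t = tm_map f' \<theta>' t"
    using map[OF mixed q(1)] map[OF assms(2) q(1)] by (auto intro: represents_unique)
  with \<open>tm_map f \<theta> t = tm_map f' \<theta> t\<close> show ?thesis by simp
qed


subsection \<open>Abstraction of nominal constants from terms\<close>

lemma represents_lam_nom:
  assumes "represents r t"
  shows "represents (Lam (nty c) (raw_close 0 c r)) (lam_nom c t)"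
  unfolding lam_nom_def
  using conv_raw_close[of "[]" "[]" "tm_ty t" "rep_tm t" r c] represents_conv[OF represents_rep assms]
  by (intro conv_represents_abs_tm[OF conv_Lam]) simp

lemma tm_ty_lam_nom [simp]: "tm_ty (lam_nom c t) = Fun (nty c) (tm_ty t)"
  using tyof_raw_close[of "[]" "[]" "rep_tm t" "tm_ty t" c]
  by (intro represents_ty[OF represents_lam_nom[OF represents_rep]]) simp

lemma supp_lam_nom: "supp (lam_nom c t) \<subseteq> supp t - {c}"
proof -
  obtain r where "represents r t" "noms r = supp t" by (rule represented_by_supp)
  with supp_subset_noms[OF represents_lam_nom[of r t c]] show ?thesis by simp
qed

lemma app_lam_nom: "tm_app (lam_nom c t) (tm_nom c) = t"
proof (rule represents_unique)
  let ?r = "raw_close 0 c (rep_tm t)"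
  have "tyof [nty c] ?r = Some (tm_ty t)"
    using tyof_raw_close[of "[]" "[]" "rep_tm t"] by simp
  then have "conv [] (tm_ty t) (App (Lam (nty c) ?r) (Nom c)) (inst 0 (Nom c) ?r)"
    by (intro conv_beta) auto
  moreover have "inst 0 (Nom c) ?r = rep_tm t"
    using inst_raw_close tyof_rep_tm by fastforce
  moreover have "represents (App (Lam (nty c) ?r) (Nom c)) (tm_app (lam_nom c t) (tm_nom c))"
    by (intro represents_app represents_lam_nom represents_nom) simp_all
  ultimately show "represents (rep_tm t) (tm_app (lam_nom c t) (tm_nom c))"
    using conv_represents by metis
qed simp

lemma lam_nom_app:
  assumes "c \<notin> supp t" "tm_ty t = Fun (nty c) B"
  shows "lam_nom c (tm_app t (tm_nom c)) = t"
proof -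
  obtain r where r: "represents r t" "noms r = supp t" by (rule represented_by_supp)
  have "represents (Lam (nty c) (raw_close 0 c (App r (Nom c)))) (lam_nom c (tm_app t (tm_nom c)))"
    using assms(2) r(1) by (intro represents_lam_nom represents_app represents_nom) simp_all
  then have "represents (Lam (nty c) (App (lift 0 r) (Bnd 0))) (lam_nom c (tm_app t (tm_nom c)))"
    using assms(1) r(2) by (simp add: raw_close_fresh)
  moreover have "conv [] (Fun (nty c) B) (Lam (nty c) (App (lift 0 r) (Bnd 0))) r"
    using represents_tyof[OF r(1)] assms(2) by (intro conv_eta) simp
  ultimately have "represents r (lam_nom c (tm_app t (tm_nom c)))" by (rule conv_represents[rotated])
  then show ?thesis using r(1) by (rule represents_unique)
qed

lemma tm_map_lam_nom:
  assumes "tm_typed f \<theta>" "f c = tm_nom d" "d \<notin> supp (tm_map f \<theta> (lam_nom c t))"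
  shows "tm_map f \<theta> (lam_nom c t) = lam_nom d (tm_map f \<theta> t)"
proof -
  have nty: "nty d = nty c" using assms(1,2) by (metis tm_typed_def tm_ty_nom)
  have "tm_map f \<theta> (lam_nom c t) = lam_nom d (tm_app (tm_map f \<theta> (lam_nom c t)) (tm_nom d))"
    using lam_nom_app[OF assms(3)] by (simp add: assms(1) nty)
  also have "\<dots> = lam_nom d (tm_map f \<theta> (tm_app (lam_nom c t) (tm_nom c)))"
    using tm_map_app[OF assms(1), of "lam_nom c t" "tm_nom c"] by (simp add: assms(1,2))
  finally show ?thesis by (simp add: app_lam_nom)
qed

lemma lam_noms_inj: "lam_noms cs t = lam_noms cs u \<Longrightarrow> t = u"
  by (induction cs) (auto, metis app_lam_nom)

lemma supp_lam_noms: "supp (lam_noms cs t) \<subseteq> supp t - set cs"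
  by (induction cs) (auto dest: subsetD[OF supp_lam_nom])

lemma tm_ty_lam_noms [simp]: "tm_ty (lam_noms cs t) = Funs (map nty cs) (tm_ty t)"
  by (induction cs) auto

abbreviation tm_apps :: "'k::signature tm \<Rightarrow> nom list \<Rightarrow> 'k tm" where
  "tm_apps t cs \<equiv> foldl tm_app t (map tm_nom cs)"

lemma represents_apps:
  "represents r t \<Longrightarrow> tm_ty t = Funs (map nty cs) B \<Longrightarrow>
   represents (foldl App r (map Nom cs)) (tm_apps t cs)"
  by (induction cs arbitrary: r t) (simp_all add: represents_app represents_nom tm_ty_app)

lemma tm_ty_apps: "tm_ty t = Funs (map nty cs) B \<Longrightarrow> tm_ty (tm_apps t cs) = B"
  by (induction cs arbitrary: t) (auto simp: tm_ty_app)

lemma supp_apps: "tm_ty t = Funs (map nty cs) B \<Longrightarrow> supp (tm_apps t cs) \<subseteq> supp t \<union> set cs"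
proof (induction cs arbitrary: t)
  case (Cons c cs)
  have "supp (tm_app t (tm_nom c)) \<subseteq> supp t \<union> {c}"
    using supp_app[of t "tm_nom c"] supp_nom[of c] Cons.prems by fastforce
  with Cons.IH[of "tm_app t (tm_nom c)"] Cons.prems show ?case by (fastforce simp: tm_ty_app)
qed simp

lemma tm_map_apps:
  "tm_typed f \<theta> \<Longrightarrow> tm_ty t = Funs (map nty cs) B \<Longrightarrow>
   tm_map f \<theta> (tm_apps t cs) = foldl tm_app (tm_map f \<theta> t) (map f cs)"
proof (induction cs arbitrary: t)
  case (Cons c cs)
  then show ?case using tm_map_app[of f \<theta> t "tm_nom c"] by (simp add: tm_ty_app)
qed simp

lemma apps_lam_noms: "tm_apps (lam_noms cs t) cs = t"
  by (induction cs) (auto simp: app_lam_nom)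


subsection \<open>Permuting and substituting in terms\<close>

lemma is_subst_ty: "is_subst \<theta> \<Longrightarrow> tm_ty (\<theta> x) = vty x"
  by (simp add: is_subst_def)

lemma tm_typed_renaming: "renaming \<delta> \<Longrightarrow> tm_typed (\<lambda>c. tm_nom (\<delta> c)) tm_var"
  by (simp add: tm_typed_def)

lemma tm_typed_subst: "is_subst \<theta> \<Longrightarrow> tm_typed tm_nom \<theta>"
  by (simp add: tm_typed_def is_subst_def)

lemma represents_perm:
  assumes "renaming \<delta>"
  shows "represents (raw_perm \<delta> (rep_tm t)) (tm_perm \<delta> t)"
  unfolding tm_perm_def raw_perm_eq_raw_map
  by (rule represents_abs_tm, rule tyof_raw_map[OF _ tyof_rep_tm])
    (simp add: raw_typed_def assms)

lemma tm_perm_eq_tm_map: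
  assumes "renaming \<delta>"
  shows "tm_perm \<delta> t = tm_map (\<lambda>c. tm_nom (\<delta> c)) tm_var t"
  using represents_perm[OF assms, unfolded raw_perm_eq_raw_map]
    represents_map[OF tm_typed_renaming[OF assms] represents_nom represents_var represents_rep]
  by (rule represents_unique)

lemma tm_subst_eq_tm_map:
  assumes "is_subst \<theta>"
  shows "tm_subst t \<theta> = tm_map tm_nom \<theta> t"
  using represents_map[OF tm_typed_subst[OF assms] represents_nom represents_rep represents_rep]
  by (simp add: tm_subst_def raw_subst_eq_raw_map represents_def)

lemma tm_ty_perm [simp]: "renaming \<delta> \<Longrightarrow> tm_ty (tm_perm \<delta> t) = tm_ty t"
  by (simp add: tm_perm_eq_tm_map tm_typed_renaming)

lemma tm_ty_subst [simp]: "is_subst \<theta> \<Longrightarrow> tm_ty (tm_subst t \<theta>) = tm_ty t"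
  by (simp add: tm_subst_eq_tm_map tm_typed_subst)

lemma tm_perm_var [simp]: "renaming \<delta> \<Longrightarrow> tm_perm \<delta> (tm_var x) = tm_var x"
  by (simp add: tm_perm_eq_tm_map tm_typed_renaming)

lemma tm_subst_var [simp]: "is_subst \<theta> \<Longrightarrow> tm_subst (tm_var x) \<theta> = \<theta> x"
  by (simp add: tm_subst_eq_tm_map tm_typed_subst)

lemma perm_apps:
  "renaming \<delta> \<Longrightarrow> tm_ty t = Funs (map nty cs) B \<Longrightarrow>
   tm_perm \<delta> (tm_apps t cs) = tm_apps (tm_perm \<delta> t) (map \<delta> cs)"
  by (simp add: tm_perm_eq_tm_map tm_typed_renaming tm_map_apps comp_def)

lemma subst_apps:
  "is_subst \<theta> \<Longrightarrow> tm_ty t = Funs (map nty cs) B \<Longrightarrow>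
   tm_subst (tm_apps t cs) \<theta> = tm_apps (tm_subst t \<theta>) cs"
  by (simp add: tm_subst_eq_tm_map tm_typed_subst tm_map_apps)

lemma tm_perm_perm:
  "renaming \<delta> \<Longrightarrow> renaming \<delta>' \<Longrightarrow> tm_perm \<delta> (tm_perm \<delta>' t) = tm_perm (\<delta> \<circ> \<delta>') t"
  by (simp add: tm_perm_eq_tm_map tm_typed_renaming tm_map_map)

lemma tm_perm_cong:
  assumes "renaming \<delta>" "renaming \<delta>'" "\<And>c. c \<in> supp t \<Longrightarrow> \<delta> c = \<delta>' c"
  shows "tm_perm \<delta> t = tm_perm \<delta>' t"
  using assms by (auto simp: tm_perm_eq_tm_map tm_typed_renaming intro!: tm_map_cong)

lemma tm_perm_id [simp]: "tm_perm id t = t"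
  by (simp add: tm_perm_eq_tm_map)

lemma tm_perm_ident:
  assumes "renaming \<delta>" "\<And>c. c \<in> supp t \<Longrightarrow> \<delta> c = c"
  shows "tm_perm \<delta> t = t"
  using tm_perm_cong[OF assms(1) renaming_id, of t] assms(2) by simp

lemma tm_perm_inv [simp]: "is_perm \<pi> \<Longrightarrow> tm_perm (inv \<pi>) (tm_perm \<pi> t) = t"
  by (simp add: tm_perm_perm tm_perm_ident)

lemma tm_perm_identify:
  assumes "finite {c. \<delta> c \<noteq> c}" "renaming \<delta>"
    and "\<And>c. \<delta> c \<noteq> c \<Longrightarrow> \<delta> c \<notin> supp (tm_perm \<delta> t)"
  shows "tm_perm \<delta> t = t"
proof -
  obtain r where r: "represents r (tm_perm \<delta> t)" "noms r = supp (tm_perm \<delta> t)"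
    by (rule represented_by_supp)
  have "conv [] (tm_ty t) (raw_perm \<delta> (rep_tm t)) r"
    using represents_conv[OF represents_perm r(1)] assms(2) by simp
  then have "conv [] (tm_ty t) (rep_tm t) r"
    using assms(3) r(2) by (intro conv_identify[OF assms(1) _ tyof_rep_tm]) auto
  then have "represents r t" using represents_rep by (rule conv_represents)
  with r(1) show ?thesis by (rule represents_unique)
qed

lemma supp_perm:
  assumes "is_perm \<pi>"
  shows "supp (tm_perm \<pi> t) = \<pi> ` supp t"
proof
  have subset: "supp (tm_perm \<pi> t) \<subseteq> \<pi> ` supp t" if "is_perm \<pi>" for \<pi> and t :: "'a tm"
    using supp_map[OF tm_typed_renaming, of \<pi> t] supp_nom that
    by (fastforce simp: tm_perm_eq_tm_map)
  show "supp (tm_perm \<pi> t) \<subseteq> \<pi> ` supp t" by (rule subset[OF assms])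
  have "supp t \<subseteq> inv \<pi> ` supp (tm_perm \<pi> t)"
    using subset[of "inv \<pi>" "tm_perm \<pi> t"] assms by simp
  then show "\<pi> ` supp t \<subseteq> supp (tm_perm \<pi> t)" using assms by force
qed

lemma supp_tm_subst: "is_subst \<theta> \<Longrightarrow> supp (tm_subst t \<theta>) \<subseteq> supp t \<union> supp_subst \<theta>"
  using supp_map[OF tm_typed_subst, of \<theta> t] supp_nom
  by (fastforce simp: tm_subst_eq_tm_map supp_subst_def)

lemma supp_subset_supp_subst: "supp (\<theta> x) \<subseteq> supp_subst \<theta>"
  by (auto simp: supp_subst_def)

lemma finite_supp_subst:
  assumes "is_subst \<theta>"
  shows "finite (supp_subst \<theta>)"
proof -
  have "supp_subst \<theta> \<subseteq> (\<Union>x\<in>{x. \<theta> x \<noteq> tm_var x}. supp (\<theta> x))"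
    by (auto simp: supp_subst_def) (metis empty_iff supp_var)
  then show ?thesis
    by (rule finite_subset) (use assms in \<open>auto simp: is_subst_def\<close>)
qed

lemma is_substI:
  assumes "\<And>x. tm_ty (\<theta> x) = vty x" "finite X" "\<And>x. x \<notin> X \<Longrightarrow> \<theta> x = tm_var x"
  shows "is_subst \<theta>"
proof -
  have "{x. \<theta> x \<noteq> tm_var x} \<subseteq> X" using assms(3) by auto
  then show ?thesis using assms(1,2) by (auto simp: is_subst_def intro: finite_subset)
qed

lemma supp_restr: "supp_subst (restr \<Sigma> \<theta>) = (\<Union>x\<in>\<Sigma>. supp (\<theta> x))"
  by (auto simp: supp_subst_def restr_def split: if_splits)

lemma is_subst_perm [simp]:
  assumes "renaming \<delta>" "is_subst \<theta>"
  shows "is_subst (perm_subst \<delta> \<theta>)"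
  by (rule is_substI[of _ "{x. \<theta> x \<noteq> tm_var x}"])
    (use assms in \<open>auto simp: perm_subst_def is_subst_def\<close>)

lemma is_subst_comp [simp]:
  assumes "is_subst \<theta>" "is_subst \<rho>"
  shows "is_subst (comp_subst \<theta> \<rho>)"
proof (rule is_substI[of _ "{x. \<theta> x \<noteq> tm_var x} \<union> {x. \<rho> x \<noteq> tm_var x}"])
  show "tm_ty (comp_subst \<theta> \<rho> x) = vty x" for x
    using assms by (simp add: comp_subst_def is_subst_ty)
  show "finite ({x. \<theta> x \<noteq> tm_var x} \<union> {x. \<rho> x \<noteq> tm_var x})"
    using assms by (simp add: is_subst_def)
qed (use assms in \<open>simp add: comp_subst_def\<close>)

lemma is_subst_restr [simp]:
  assumes "is_subst \<theta>"
  shows "is_subst (restr \<Sigma> \<theta>)"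
  by (rule is_substI[of _ "{x. \<theta> x \<noteq> tm_var x}"])
    (use assms in \<open>auto simp: restr_def is_subst_def\<close>)

lemma tm_perm_subst:
  assumes "renaming \<delta>" "is_subst \<theta>"
  shows "tm_perm \<delta> (tm_subst t \<theta>) = tm_subst (tm_perm \<delta> t) (perm_subst \<delta> \<theta>)"
  using assms is_subst_perm[OF assms]
  by (simp add: tm_perm_eq_tm_map tm_subst_eq_tm_map tm_map_map tm_typed_subst tm_typed_renaming
      perm_subst_def)

lemma tm_subst_subst:
  assumes "is_subst \<theta>" "is_subst \<rho>"
  shows "tm_subst (tm_subst t \<theta>) \<rho> = tm_subst t (comp_subst \<theta> \<rho>)"
  using assms is_subst_comp[OF assms]
  by (simp add: tm_subst_eq_tm_map tm_map_map tm_typed_subst comp_subst_def)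

lemma tm_subst_cong:
  assumes "is_subst \<theta>" "is_subst \<theta>'" "\<And>x. x \<in> fv t \<Longrightarrow> \<theta> x = \<theta>' x"
  shows "tm_subst t \<theta> = tm_subst t \<theta>'"
  using assms by (auto simp: tm_subst_eq_tm_map tm_typed_subst intro!: tm_map_cong)

lemma perm_subst_perm:
  "renaming \<delta> \<Longrightarrow> renaming \<delta>' \<Longrightarrow>
   perm_subst \<delta> (perm_subst \<delta>' \<theta>) = perm_subst (\<delta> \<circ> \<delta>') \<theta>"
  by (simp add: perm_subst_def tm_perm_perm)

lemma perm_subst_cong:
  "renaming \<delta> \<Longrightarrow> renaming \<delta>' \<Longrightarrow> (\<And>c. c \<in> supp_subst \<theta> \<Longrightarrow> \<delta> c = \<delta>' c) \<Longrightarrow>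
   perm_subst \<delta> \<theta> = perm_subst \<delta>' \<theta>"
  by (auto simp: perm_subst_def supp_subst_def intro!: tm_perm_cong)

lemma perm_subst_id [simp]: "perm_subst id \<theta> = \<theta>"
  by (simp add: perm_subst_def)

lemma perm_subst_ident:
  "renaming \<delta> \<Longrightarrow> (\<And>c. c \<in> supp_subst \<theta> \<Longrightarrow> \<delta> c = c) \<Longrightarrow> perm_subst \<delta> \<theta> = \<theta>"
  using perm_subst_cong[of \<delta> id \<theta>] by simp

lemma perm_subst_inv: "is_perm \<pi> \<Longrightarrow> perm_subst (inv \<pi>) (perm_subst \<pi> \<theta>) = \<theta>"
  by (simp add: perm_subst_def)

lemma supp_perm_subst: "is_perm \<pi> \<Longrightarrow> supp_subst (perm_subst \<pi> \<theta>) = \<pi> ` supp_subst \<theta>"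
  by (simp add: supp_subst_def perm_subst_def supp_perm image_UN)

lemma perm_comp_subst:
  "renaming \<delta> \<Longrightarrow> is_subst \<rho> \<Longrightarrow>
   perm_subst \<delta> (comp_subst \<theta> \<rho>) = comp_subst (perm_subst \<delta> \<theta>) (perm_subst \<delta> \<rho>)"
  by (auto simp: comp_subst_def perm_subst_def tm_perm_subst[unfolded perm_subst_def])

lemma supp_comp_subst:
  "is_subst \<rho> \<Longrightarrow> supp_subst (comp_subst \<theta> \<rho>) \<subseteq> supp_subst \<theta> \<union> supp_subst \<rho>"
  using supp_tm_subst unfolding comp_subst_def supp_subst_def by fastforce

lemma restr_perm_subst: "renaming \<delta> \<Longrightarrow> restr \<Sigma> (perm_subst \<delta> \<theta>) = perm_subst \<delta> (restr \<Sigma> \<theta>)"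
  by (auto simp: restr_def perm_subst_def)

lemma perm_lam_nom:
  assumes "is_perm \<pi>"
  shows "tm_perm \<pi> (lam_nom c t) = lam_nom (\<pi> c) (tm_perm \<pi> t)"
proof -
  have "\<pi> c \<notin> supp (tm_perm \<pi> (lam_nom c t))"
    using supp_lam_nom[of c t] by (auto simp: supp_perm assms)
  then show ?thesis
    using tm_map_lam_nom[OF tm_typed_renaming refl, of \<pi> c t] by (simp add: tm_perm_eq_tm_map assms)
qed

lemma subst_lam_nom:
  assumes "is_subst \<theta>" "c \<notin> supp_subst \<theta>"
  shows "tm_subst (lam_nom c t) \<theta> = lam_nom c (tm_subst t \<theta>)"
proof -
  have "c \<notin> supp (tm_subst (lam_nom c t) \<theta>)"
    using supp_lam_nom[of c t] supp_tm_subst[OF assms(1)] assms(2) by blast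
  then show ?thesis
    using tm_map_lam_nom[OF tm_typed_subst refl, of \<theta> c t] by (simp add: tm_subst_eq_tm_map assms(1))
qed

lemma perm_lam_noms: "is_perm \<pi> \<Longrightarrow> tm_perm \<pi> (lam_noms cs t) = lam_noms (map \<pi> cs) (tm_perm \<pi> t)"
  by (induction cs) (auto simp: perm_lam_nom)

lemma subst_lam_noms:
  "is_subst \<theta> \<Longrightarrow> set cs \<inter> supp_subst \<theta> = {} \<Longrightarrow>
   tm_subst (lam_noms cs t) \<theta> = lam_noms cs (tm_subst t \<theta>)"
  by (induction cs) (auto simp: subst_lam_nom)

lemma lam_noms_rename_avoiding:
  assumes "distinct cs" "finite Y"
  obtains ds where "distinct ds" "map nty ds = map nty cs" "lam_noms ds t = lam_noms cs t"
    "set ds \<inter> Y \<subseteq> supp t"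
proof -
  obtain \<pi> where \<pi>: "is_perm \<pi>" "\<And>c. c \<in> supp t \<Longrightarrow> \<pi> c = c" "\<pi> ` (set cs - supp t) \<inter> Y = {}"
    by (rule is_perm_avoiding_fixing[OF finite_set[of cs] finite_supp[of t] assms(2)]) blast
  have "tm_perm \<pi> t = t" using \<pi>(1,2) by (simp add: tm_perm_ident)
  moreover have "tm_perm \<pi> (lam_noms cs t) = lam_noms cs t"
    using \<pi>(1,2) supp_lam_noms[of cs t] by (intro tm_perm_ident) auto
  ultimately have "lam_noms (map \<pi> cs) t = lam_noms cs t" using perm_lam_noms[OF \<pi>(1), of cs t] by simp
  moreover have "set (map \<pi> cs) \<inter> Y \<subseteq> supp t" using \<pi>(2,3) by fastforce
  moreover have "distinct (map \<pi> cs)" "map nty (map \<pi> cs) = map nty cs"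
    using assms(1) \<pi>(1) by (simp_all add: distinct_map inj_on_def)
  ultimately show ?thesis using that by blast
qed


subsection \<open>Independence of the choice of permutations\<close>

lemma subst_equiv_sym: "subst_equiv \<theta> \<rho> \<Longrightarrow> subst_equiv \<rho> \<theta>"
  unfolding subst_equiv_def by (metis is_perm_inv perm_subst_inv)

lemma subst_equiv_trans: "subst_equiv \<theta> \<rho> \<Longrightarrow> subst_equiv \<rho> \<sigma> \<Longrightarrow> subst_equiv \<theta> \<sigma>"
  unfolding subst_equiv_def by (metis is_perm_comp is_perm_renaming perm_subst_perm)

lemma subst_equiv_perm_subst: "is_perm \<pi> \<Longrightarrow> subst_equiv (perm_subst \<pi> \<theta>) \<theta>"
  by (auto simp: subst_equiv_def)

lemma subst_equiv_restr: "subst_equiv \<theta> \<rho> \<Longrightarrow> subst_equiv (restr \<Sigma> \<theta>) (restr \<Sigma> \<rho>)"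
  by (auto simp: subst_equiv_def restr_perm_subst)

lemma nom_comp_choice:
  assumes "is_subst \<theta>" "is_subst \<rho>"
  obtains \<pi> where "is_perm \<pi>" "\<pi> ` supp_subst \<theta> \<inter> supp_subst \<rho> = {}"
    "nom_comp \<theta> \<rho> = comp_subst (perm_subst \<pi> \<theta>) \<rho>"
proof -
  let ?P = "\<lambda>\<pi>. is_perm \<pi> \<and> supp_subst (perm_subst \<pi> \<theta>) \<inter> supp_subst \<rho> = {}"
  define \<pi> where "\<pi> = (SOME \<pi>. ?P \<pi>)"
  obtain \<pi>' where "is_perm \<pi>'" "\<pi>' ` supp_subst \<theta> \<inter> supp_subst \<rho> = {}"
    by (rule is_perm_avoiding[OF finite_supp_subst[OF assms(1)] finite_supp_subst[OF assms(2)]])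
  then have "?P \<pi>" unfolding \<pi>_def by (intro someI[of ?P \<pi>']) (simp add: supp_perm_subst)
  moreover have "nom_comp \<theta> \<rho> = comp_subst (perm_subst \<pi> \<theta>) \<rho>"
    by (simp add: nom_comp_def \<pi>_def)
  ultimately show ?thesis using that[of \<pi>] by (auto simp: supp_perm_subst)
qed

lemma is_subst_nom_comp:
  assumes "is_subst \<theta>" "is_subst \<rho>"
  shows "is_subst (nom_comp \<theta> \<rho>)"
  using nom_comp_choice[OF assms] assms by (metis is_perm_renaming is_subst_comp is_subst_perm)

lemma subst_equiv_nom_comp:
  assumes "is_subst \<theta>" "is_subst \<rho>" "is_perm \<pi>" "\<pi> ` supp_subst \<theta> \<inter> supp_subst \<rho> = {}"
  shows "subst_equiv (comp_subst (perm_subst \<pi> \<theta>) \<rho>) (nom_comp \<theta> \<rho>)"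
proof -
  obtain \<pi>' where \<pi>': "is_perm \<pi>'" "\<pi>' ` supp_subst \<theta> \<inter> supp_subst \<rho> = {}"
    "nom_comp \<theta> \<rho> = comp_subst (perm_subst \<pi>' \<theta>) \<rho>"
    by (rule nom_comp_choice[OF assms(1,2)])
  obtain \<mu> where \<mu>: "is_perm \<mu>" "\<And>c. c \<in> supp_subst \<theta> \<Longrightarrow> \<mu> (\<pi>' c) = \<pi> c"
    "\<And>c. c \<in> supp_subst \<rho> \<Longrightarrow> \<mu> c = c"
    using is_perm_relating[OF \<pi>'(1,2) assms(3,4)] assms(1,2) finite_supp_subst by metis
  have "perm_subst \<mu> (nom_comp \<theta> \<rho>) = comp_subst (perm_subst (\<mu> \<circ> \<pi>') \<theta>) (perm_subst \<mu> \<rho>)"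
    by (simp add: \<pi>' \<mu>(1) assms(2) perm_comp_subst perm_subst_perm)
  also have "perm_subst (\<mu> \<circ> \<pi>') \<theta> = perm_subst \<pi> \<theta>"
    using \<mu>(1,2) \<pi>'(1) assms(3) by (intro perm_subst_cong) auto
  also have "perm_subst \<mu> \<rho> = \<rho>" using \<mu>(1,3) by (simp add: perm_subst_ident)
  finally show ?thesis using subst_equiv_perm_subst[OF \<mu>(1), of "nom_comp \<theta> \<rho>"] by simp
qed

lemma less_general_onI:
  assumes "is_subst \<theta>" "is_subst \<gamma>" "supp_subst (restr \<Sigma> \<theta>) \<inter> supp_subst \<gamma> = {}"
    and "is_perm \<kappa>" "\<And>h. h \<in> \<Sigma> \<Longrightarrow> comp_subst \<theta> \<gamma> h = tm_perm \<kappa> (\<rho> h)"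
  shows "less_general_on \<Sigma> \<rho> \<theta>"
proof -
  have "subst_equiv (comp_subst (restr \<Sigma> \<theta>) \<gamma>) (nom_comp (restr \<Sigma> \<theta>) \<gamma>)"
    using subst_equiv_nom_comp[of "restr \<Sigma> \<theta>" \<gamma> id] assms(1-3) by simp
  moreover have "restr \<Sigma> (comp_subst (restr \<Sigma> \<theta>) \<gamma>) = perm_subst \<kappa> (restr \<Sigma> \<rho>)"
    using assms(4,5) by (auto simp: restr_def comp_subst_def perm_subst_def)
  ultimately have "subst_equiv (perm_subst \<kappa> (restr \<Sigma> \<rho>)) (restr \<Sigma> (nom_comp (restr \<Sigma> \<theta>) \<gamma>))"
    using subst_equiv_restr by metis
  then have "subst_equiv (restr \<Sigma> \<rho>) (restr \<Sigma> (nom_comp (restr \<Sigma> \<theta>) \<gamma>))"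
    using subst_equiv_perm_subst[OF assms(4)] subst_equiv_sym subst_equiv_trans by metis
  then show ?thesis using assms(2) by (auto simp: less_general_on_def)
qed

lemma less_general_on_subst_equiv:
  "subst_equiv \<rho> \<rho>' \<Longrightarrow> less_general_on \<Sigma> \<rho>' \<theta> \<Longrightarrow> less_general_on \<Sigma> \<rho> \<theta>"
  unfolding less_general_on_def using subst_equiv_restr subst_equiv_trans by blast

lemma finite_supp_form [simp]: "finite (supp_form B)"
  by (cases B) simp

lemma perm_form_perm:
  "renaming \<delta> \<Longrightarrow> renaming \<delta>' \<Longrightarrow> perm_form \<delta> (perm_form \<delta>' B) = perm_form (\<delta> \<circ> \<delta>') B"
  by (cases B) (simp add: tm_perm_perm)

lemma perm_form_cong:
  "renaming \<delta> \<Longrightarrow> renaming \<delta>' \<Longrightarrow> (\<And>c. c \<in> supp_form B \<Longrightarrow> \<delta> c = \<delta>' c) \<Longrightarrow>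
   perm_form \<delta> B = perm_form \<delta>' B"
  by (cases B) (auto intro: tm_perm_cong)

lemma perm_subst_form:
  "renaming \<delta> \<Longrightarrow> is_subst \<theta> \<Longrightarrow>
   perm_form \<delta> (subst_form B \<theta>) = subst_form (perm_form \<delta> B) (perm_subst \<delta> \<theta>)"
  by (cases B) (simp add: tm_perm_subst)

lemma holds_perm_form:
  assumes "is_perm \<pi>" "holds B"
  shows "holds (perm_form \<pi> B)"
proof (cases B)
  case (NAbs n s t)
  with assms(2) obtain cs where "length cs = n" "distinct cs" "s = lam_noms cs t" by auto
  then have "length (map \<pi> cs) = n" "distinct (map \<pi> cs)"
    "tm_perm \<pi> s = lam_noms (map \<pi> cs) (tm_perm \<pi> t)"
    using assms(1) by (auto simp: perm_lam_noms distinct_map inj_on_def)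
  then show ?thesis unfolding NAbs perm_form.simps holds.simps by blast
qed

lemma holds_subst_form_independent:
  assumes "is_subst \<theta>" and \<pi>: "is_perm \<pi>" "\<pi> ` supp_form B \<inter> supp_subst \<theta> = {}"
    and \<pi>': "is_perm \<pi>'" "\<pi>' ` supp_form B \<inter> supp_subst \<theta> = {}"
    and holds: "holds (subst_form (perm_form \<pi> B) \<theta>)"
  shows "holds (subst_form (perm_form \<pi>' B) \<theta>)"
proof -
  obtain \<mu> where \<mu>: "is_perm \<mu>" "\<And>c. c \<in> supp_form B \<Longrightarrow> \<mu> (\<pi> c) = \<pi>' c"
    "\<And>c. c \<in> supp_subst \<theta> \<Longrightarrow> \<mu> c = c"
    by (rule is_perm_relating[OF \<pi> \<pi>' finite_supp_form finite_supp_subst[OF assms(1)]]) blast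
  have "perm_form \<mu> (perm_form \<pi> B) = perm_form \<pi>' B"
    using \<pi>(1) \<pi>'(1) \<mu>(1,2) by (simp add: perm_form_perm) (rule perm_form_cong, auto)
  moreover have "perm_subst \<mu> \<theta> = \<theta>" using \<mu>(1,3) by (simp add: perm_subst_ident)
  ultimately show ?thesis
    using holds_perm_form[OF \<mu>(1) holds] \<mu>(1) assms(1) by (simp add: perm_subst_form)
qed

lemma na_solution_iff:
  assumes "is_subst \<theta>" "is_perm \<pi>" "\<pi> ` supp_form B \<inter> supp_subst \<theta> = {}"
  shows "na_solution B \<theta> \<longleftrightarrow> holds (subst_form (perm_form \<pi> B) \<theta>)"
proof -
  let ?P = "\<lambda>\<pi>. is_perm \<pi> \<and> \<pi> ` supp_form B \<inter> supp_subst \<theta> = {}"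
  define \<pi>' where "\<pi>' = (SOME \<pi>. ?P \<pi>)"
  have "?P \<pi>'" unfolding \<pi>'_def using assms(2,3) by (intro someI[of ?P]) simp
  then have "holds (subst_form (perm_form \<pi>' B) \<theta>) \<longleftrightarrow> holds (subst_form (perm_form \<pi> B) \<theta>)"
    using holds_subst_form_independent[OF assms(1), of _ B] assms(2,3) by metis
  then show ?thesis by (simp add: na_solution_def nom_subst_form_def assms(1) \<pi>'_def)
qed

lemma na_solution_subst_equiv:
  assumes "na_solution B \<theta>" "subst_equiv \<rho> \<theta>"
  shows "na_solution B \<rho>"
proof -
  obtain \<mu> where \<mu>: "is_perm \<mu>" and \<rho>: "\<rho> = perm_subst \<mu> \<theta>"
    using assms(2) by (auto simp: subst_equiv_def)
  have \<theta>: "is_subst \<theta>" using assms(1) by (simp add: na_solution_def)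
  obtain \<pi> where \<pi>: "is_perm \<pi>" "\<pi> ` supp_form B \<inter> supp_subst \<theta> = {}"
    by (rule is_perm_avoiding[OF finite_supp_form finite_supp_subst[OF \<theta>]])
  have "holds (perm_form \<mu> (subst_form (perm_form \<pi> B) \<theta>))"
    using assms(1) na_solution_iff[OF \<theta> \<pi>] by (simp add: holds_perm_form \<mu>)
  then have "holds (subst_form (perm_form (\<mu> \<circ> \<pi>) B) \<rho>)"
    by (simp add: perm_subst_form perm_form_perm \<mu> \<theta> \<pi>(1) \<rho>)
  moreover have "(\<mu> \<circ> \<pi>) ` supp_form B \<inter> supp_subst \<rho> = {}"
    using \<pi>(2) \<mu> by (auto simp: \<rho> supp_perm_subst)
  ultimately show ?thesis
    using na_solution_iff[of \<rho> "\<mu> \<circ> \<pi>" B] \<mu> \<pi>(1) \<theta> by (simp add: \<rho>)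
qed


subsection \<open>Separating the constants of a unifier from those of its instances\<close>

lemma comp_subst_perm_subst_right:
  assumes \<theta>: "is_subst \<theta>" and \<gamma>: "is_subst \<gamma>" and \<kappa>: "is_perm \<kappa>"
    and avoid: "\<kappa> ` supp_subst \<gamma> \<inter> (supp_subst \<gamma> \<union> supp_subst \<theta>) = {}"
    and disjoint: "supp (comp_subst \<theta> \<gamma> x) \<inter> supp_subst \<gamma> = {}"
  shows "comp_subst \<theta> (perm_subst \<kappa> \<gamma>) x = comp_subst \<theta> \<gamma> x"
proof -
  let ?\<gamma> = "perm_subst \<kappa> \<gamma>"
  define \<delta> where "\<delta> c = (if c \<in> \<kappa> ` supp_subst \<gamma> then inv \<kappa> c else c)" for c
  have "nty (inv \<kappa> c) = nty c" for c using \<kappa> by simp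
  then have \<delta>: "renaming \<delta>" by (simp add: renaming_def \<delta>_def)
  have "perm_subst \<delta> ?\<gamma> = \<gamma>"
    using \<kappa> \<delta> by (simp add: perm_subst_perm) (rule perm_subst_ident, auto simp: \<delta>_def)
  moreover have "perm_subst \<delta> \<theta> = \<theta>"
    using avoid \<delta> by (intro perm_subst_ident) (auto simp: \<delta>_def)
  ultimately have "perm_subst \<delta> (comp_subst \<theta> ?\<gamma>) = comp_subst \<theta> \<gamma>"
    using perm_comp_subst[OF \<delta>, of ?\<gamma> \<theta>] \<kappa> \<gamma> by simp
  then have \<delta>_comp: "tm_perm \<delta> (comp_subst \<theta> ?\<gamma> x) = comp_subst \<theta> \<gamma> x"
    by (metis perm_subst_def)
  have "tm_perm \<delta> (comp_subst \<theta> ?\<gamma> x) = comp_subst \<theta> ?\<gamma> x"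
  proof (rule tm_perm_identify[OF _ \<delta>])
    have "{c. \<delta> c \<noteq> c} \<subseteq> \<kappa> ` supp_subst \<gamma>" by (auto simp: \<delta>_def)
    then show "finite {c. \<delta> c \<noteq> c}"
      using finite_supp_subst[OF \<gamma>] by (auto intro: finite_subset)
    fix c assume "\<delta> c \<noteq> c"
    then have "\<delta> c \<in> supp_subst \<gamma>" using \<kappa> by (auto simp: \<delta>_def split: if_splits)
    then show "\<delta> c \<notin> supp (tm_perm \<delta> (comp_subst \<theta> ?\<gamma> x))" using disjoint by (auto simp: \<delta>_comp)
  qed
  then show ?thesis by (simp add: \<delta>_comp)
qed

lemma separate_instance:
  assumes "is_subst \<theta>" "is_subst \<gamma>" "finite Y"
  obtains \<gamma>' where "is_subst \<gamma>'" "supp_subst \<gamma>' \<inter> Y = {}"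
    "\<And>x. supp (comp_subst \<theta> \<gamma> x) \<inter> supp_subst \<gamma> = {} \<Longrightarrow> comp_subst \<theta> \<gamma>' x = comp_subst \<theta> \<gamma> x"
proof -
  have "finite (supp_subst \<gamma>)" "finite (Y \<union> supp_subst \<gamma> \<union> supp_subst \<theta>)"
    using assms by (simp_all add: finite_supp_subst)
  then obtain \<kappa> where \<kappa>: "is_perm \<kappa>"
    "\<kappa> ` supp_subst \<gamma> \<inter> (Y \<union> supp_subst \<gamma> \<union> supp_subst \<theta>) = {}"
    by (rule is_perm_avoiding)
  show ?thesis
  proof
    show "is_subst (perm_subst \<kappa> \<gamma>)" using \<kappa>(1) assms(2) by simp
    show "supp_subst (perm_subst \<kappa> \<gamma>) \<inter> Y = {}" using \<kappa> by (auto simp: supp_perm_subst)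
  qed (use \<kappa> assms in \<open>intro comp_subst_perm_subst_right; auto\<close>)
qed

definition noms_to_vars :: "nom set \<Rightarrow> (nom \<Rightarrow> var) \<Rightarrow> 'k::signature tm \<Rightarrow> 'k tm" where
  "noms_to_vars D z = tm_map (\<lambda>d. if d \<in> D then tm_var (z d) else tm_nom d) tm_var"

definition vars_to_noms :: "nom set \<Rightarrow> (nom \<Rightarrow> var) \<Rightarrow> (nom \<Rightarrow> nom) \<Rightarrow> 'k::signature subst" where
  "vars_to_noms D z \<kappa> = (\<lambda>x. if x \<in> z ` D then tm_nom (\<kappa> (inv_into D z x)) else tm_var x)"

context
  fixes D :: "nom set" and z :: "nom \<Rightarrow> var"
  assumes vty_z: "\<And>d. vty (z d) = nty d"
begin

lemma tm_typed_noms_to_vars: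
  "tm_typed (\<lambda>d. if d \<in> D then tm_var (z d) else tm_nom d :: 'k::signature tm) tm_var"
  by (simp add: tm_typed_def vty_z)

lemma supp_noms_to_vars: "supp (noms_to_vars D z t) \<subseteq> supp t - D"
  using supp_map[OF tm_typed_noms_to_vars, of t] supp_nom
  by (fastforce simp: noms_to_vars_def split: if_splits)

lemma is_subst_noms_to_vars:
  assumes "is_subst \<rho>"
  shows "is_subst (\<lambda>x. noms_to_vars D z (\<rho> x))"
  by (rule is_substI[of _ "{x. \<rho> x \<noteq> tm_var x}"])
    (use assms in \<open>auto simp: noms_to_vars_def tm_typed_noms_to_vars is_subst_def\<close>)

lemma noms_to_vars_subst:
  assumes "is_subst \<rho>" "supp t \<inter> D = {}"
  shows "noms_to_vars D z (tm_subst t \<rho>) = tm_subst t (\<lambda>x. noms_to_vars D z (\<rho> x))"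
proof -
  let ?f = "\<lambda>d. if d \<in> D then tm_var (z d) else tm_nom d :: 'a tm"
  have "noms_to_vars D z (tm_subst t \<rho>) = tm_map ?f (\<lambda>x. noms_to_vars D z (\<rho> x)) t"
    by (simp add: noms_to_vars_def tm_subst_eq_tm_map tm_map_map tm_typed_subst
        tm_typed_noms_to_vars assms(1))
  also have "\<dots> = tm_map tm_nom (\<lambda>x. noms_to_vars D z (\<rho> x)) t"
    using assms is_subst_ty[OF is_subst_noms_to_vars[OF assms(1)]]
    by (intro tm_map_cong) (auto simp: tm_typed_def vty_z)
  finally show ?thesis by (simp add: tm_subst_eq_tm_map is_subst_noms_to_vars assms(1))
qed

lemma unifier_noms_to_vars:
  assumes "unifier u v \<rho>" "(supp u \<union> supp v) \<inter> D = {}"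
  shows "unifier u v (\<lambda>x. noms_to_vars D z (\<rho> x))"
  unfolding unifier_def
proof (intro conjI)
  have \<rho>: "is_subst \<rho>" "tm_subst u \<rho> = tm_subst v \<rho>" "supp_subst \<rho> \<inter> (supp u \<union> supp v) = {}"
    using assms(1) by (simp_all add: unifier_def)
  show "is_subst (\<lambda>x. noms_to_vars D z (\<rho> x))" by (rule is_subst_noms_to_vars[OF \<rho>(1)])
  show "tm_subst u (\<lambda>x. noms_to_vars D z (\<rho> x)) = tm_subst v (\<lambda>x. noms_to_vars D z (\<rho> x))"
    using noms_to_vars_subst[OF \<rho>(1), of u] noms_to_vars_subst[OF \<rho>(1), of v] \<rho>(2) assms(2)
    by (simp add: Int_Un_distrib2)
  show "supp_subst (\<lambda>x. noms_to_vars D z (\<rho> x)) \<inter> (supp u \<union> supp v) = {}"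
    using \<rho>(3) supp_noms_to_vars unfolding supp_subst_def by blast
qed

context
  assumes inj_z: "inj_on z D"
begin

lemma vars_to_noms_apply: "d \<in> D \<Longrightarrow> vars_to_noms D z \<kappa> (z d) = tm_nom (\<kappa> d)"
  by (simp add: vars_to_noms_def inj_z)

lemma is_subst_vars_to_noms:
  assumes "finite D" "renaming \<kappa>"
  shows "is_subst (vars_to_noms D z \<kappa>)"
  by (rule is_substI[of _ "z ` D"])
    (use assms inj_z in \<open>auto simp: vars_to_noms_def vty_z\<close>)

lemma supp_vars_to_noms: "supp_subst (vars_to_noms D z \<kappa>) \<subseteq> \<kappa> ` D"
proof -
  have "supp (vars_to_noms D z \<kappa> x) \<subseteq> \<kappa> ` D" for x
    using supp_nom inj_z by (cases "x \<in> z ` D") (fastforce simp: vars_to_noms_def)+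
  then show ?thesis by (auto simp: supp_subst_def)
qed

lemma subst_noms_to_vars:
  assumes "finite D" "renaming \<kappa>" "supp t \<subseteq> D" "fv t \<inter> z ` D = {}"
  shows "tm_subst (noms_to_vars D z t) (vars_to_noms D z \<kappa>) = tm_perm \<kappa> t"
proof -
  let ?\<zeta> = "vars_to_noms D z \<kappa> :: 'a subst"
  let ?f = "\<lambda>d. if d \<in> D then tm_var (z d) else tm_nom d :: 'a tm"
  note \<zeta> = is_subst_vars_to_noms[OF assms(1,2)]
  have "tm_subst (noms_to_vars D z t) ?\<zeta> = tm_map (\<lambda>d. tm_map tm_nom ?\<zeta> (?f d)) ?\<zeta> t"
    by (simp add: noms_to_vars_def tm_subst_eq_tm_map tm_map_map tm_typed_subst
        tm_typed_noms_to_vars \<zeta>)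
  also have "\<dots> = tm_map (\<lambda>d. tm_nom (\<kappa> d)) tm_var t"
  proof (rule tm_map_cong)
    show "tm_typed (\<lambda>d. tm_map tm_nom ?\<zeta> (?f d)) ?\<zeta>"
      using tm_typed_map[OF tm_typed_subst[OF \<zeta>] tm_typed_noms_to_vars]
      by (simp add: tm_typed_subst \<zeta>)
    show "tm_map tm_nom ?\<zeta> (?f d) = tm_nom (\<kappa> d)" if "d \<in> supp t" for d
      using that assms(3) by (auto simp: tm_typed_subst \<zeta> vars_to_noms_apply)
    show "?\<zeta> x = tm_var x" if "x \<in> fv t" for x
      using that assms(4) by (auto simp: vars_to_noms_def)
  qed (rule tm_typed_renaming[OF assms(2)])
  finally show ?thesis by (simp add: tm_perm_eq_tm_map assms(2))
qed

lemma instance_renaming_avoiding: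
  fixes \<theta> \<gamma> \<rho> :: "'k::signature subst"
  assumes \<theta>: "is_subst \<theta>" and \<gamma>: "is_subst \<gamma>" and "finite D"
    and inst: "\<And>x. x \<in> W \<Longrightarrow> comp_subst \<theta> \<gamma> x = noms_to_vars D z (\<rho> x)"
    and atoms: "\<And>x. x \<in> W \<Longrightarrow> supp (\<rho> x) \<subseteq> D \<and> fv (\<rho> x) \<inter> z ` D = {}"
    and \<kappa>: "renaming \<kappa>" and Y: "finite Y" "\<kappa> ` D \<inter> Y = {}"
  shows "\<exists>\<gamma>'. is_subst \<gamma>' \<and> supp_subst \<gamma>' \<inter> Y = {} \<and>
    (\<forall>x\<in>W. comp_subst \<theta> \<gamma>' x = tm_perm \<kappa> (\<rho> x))"
proof -
  obtain \<delta> where \<delta>: "is_subst \<delta>" "supp_subst \<delta> \<inter> Y = {}" and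
    separated: "\<And>x. supp (comp_subst \<theta> \<gamma> x) \<inter> supp_subst \<gamma> = {} \<Longrightarrow>
      comp_subst \<theta> \<delta> x = comp_subst \<theta> \<gamma> x"
    by (rule separate_instance[OF \<theta> \<gamma> Y(1)]) blast
  let ?\<zeta> = "vars_to_noms D z \<kappa> :: 'k subst"
  have \<zeta>: "is_subst ?\<zeta>" by (rule is_subst_vars_to_noms[OF assms(3) \<kappa>])
  have "supp_subst (comp_subst \<delta> ?\<zeta>) \<inter> Y = {}"
    using supp_comp_subst[OF \<zeta>, of \<delta>] supp_vars_to_noms[of \<kappa>] \<delta>(2) Y(2) by blast
  moreover have "comp_subst \<theta> (comp_subst \<delta> ?\<zeta>) x = tm_perm \<kappa> (\<rho> x)" if x: "x \<in> W" for x
  proof -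
    have "supp (noms_to_vars D z (\<rho> x)) = {}"
      using supp_noms_to_vars[of "\<rho> x"] atoms[OF x] by blast
    then have "tm_subst (\<theta> x) \<delta> = noms_to_vars D z (\<rho> x)"
      using separated[of x] inst[OF x] by (simp add: comp_subst_def)
    then have "comp_subst \<theta> (comp_subst \<delta> ?\<zeta>) x = tm_subst (noms_to_vars D z (\<rho> x)) ?\<zeta>"
      by (simp add: comp_subst_def[of \<theta>] tm_subst_subst[OF \<delta>(1) \<zeta>, symmetric])
    also have "\<dots> = tm_perm \<kappa> (\<rho> x)"
      using atoms[OF x] by (intro subst_noms_to_vars[OF assms(3) \<kappa>]) auto
    finally show ?thesis .
  qed
  ultimately show ?thesis using is_subst_comp[OF \<delta>(1) \<zeta>] by blast
qed

end

end

lemma complete_unifiersD: "complete_unifiers W u v U \<Longrightarrow> \<theta> \<in> U \<Longrightarrow> unifier u v \<theta>"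
  by (simp add: complete_unifiers_def)

lemma complete_unifiers_cover:
  assumes complete: "complete_unifiers W u v U" and unif: "unifier u v \<rho>" and "finite W"
  obtains \<theta> where "\<theta> \<in> U"
    "\<And>\<kappa> Y. renaming \<kappa> \<Longrightarrow> finite Y \<Longrightarrow> \<kappa> ` supp_subst \<rho> \<inter> Y = {} \<Longrightarrow>
      \<exists>\<gamma>. is_subst \<gamma> \<and> supp_subst \<gamma> \<inter> Y = {} \<and> (\<forall>x\<in>W. comp_subst \<theta> \<gamma> x = tm_perm \<kappa> (\<rho> x))"
proof -
  let ?D = "supp_subst \<rho>"
  have finite_D: "finite ?D" using unif by (simp add: unifier_def finite_supp_subst)
  have "finite (\<Union>x\<in>W. fv (\<rho> x))" using assms(3) by simp
  then obtain z :: "nom \<Rightarrow> var" where z: "inj z" "\<And>d. vty (z d) = nty d"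
    and z_fresh: "range z \<inter> (\<Union>x\<in>W. fv (\<rho> x)) = {}" by (rule fresh_vars) blast
  have inj_z: "inj_on z ?D" using z(1) by (simp add: inj_on_def)
  have "unifier u v (\<lambda>x. noms_to_vars ?D z (\<rho> x))"
    using unif by (intro unifier_noms_to_vars z(2)) (auto simp: unifier_def)
  then have "\<exists>\<theta>\<in>U. \<exists>\<gamma>. is_subst \<gamma> \<and>
      (\<forall>x \<in> W \<union> fv u \<union> fv v. noms_to_vars ?D z (\<rho> x) = comp_subst \<theta> \<gamma> x)"
    using complete by (simp add: complete_unifiers_def)
  then obtain \<theta> \<gamma> where "\<theta> \<in> U" and \<gamma>: "is_subst \<gamma>"
    and inst: "\<And>x. x \<in> W \<Longrightarrow> comp_subst \<theta> \<gamma> x = noms_to_vars ?D z (\<rho> x)"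
    by (metis UnCI)
  have \<theta>: "is_subst \<theta>" using complete_unifiersD[OF complete \<open>\<theta> \<in> U\<close>] by (simp add: unifier_def)
  have "supp (\<rho> x) \<subseteq> ?D \<and> fv (\<rho> x) \<inter> z ` ?D = {}" if "x \<in> W" for x
    using that z_fresh supp_subset_supp_subst[of \<rho> x] by blast
  from instance_renaming_avoiding[OF z(2) inj_z \<theta> \<gamma> finite_D inst this]
  show ?thesis by (rule that[OF \<open>\<theta> \<in> U\<close>])
qed


subsection \<open>Unifiers yield solutions\<close>

lemma unifier_lam_noms_strip:
  assumes "unifier (lam_noms bs s) (lam_noms bs t) \<rho>" "finite X"
  obtains \<pi> where "is_perm \<pi>" "\<pi> ` X \<inter> supp_subst \<rho> = {}"
    "tm_subst (tm_perm \<pi> s) \<rho> = tm_subst (tm_perm \<pi> t) \<rho>"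
proof -
  let ?u = "lam_noms bs s" and ?v = "lam_noms bs t"
  let ?K = "supp ?u \<union> supp ?v"
  have \<rho>: "is_subst \<rho>" and eq: "tm_subst ?u \<rho> = tm_subst ?v \<rho>" and K: "supp_subst \<rho> \<inter> ?K = {}"
    using assms(1) by (auto simp: unifier_def)
  have "finite (X \<union> set bs)" "finite ?K" using assms(2) by simp_all
  then obtain \<pi> where \<pi>: "is_perm \<pi>" "\<And>c. c \<in> ?K \<Longrightarrow> \<pi> c = c"
    "\<pi> ` (X \<union> set bs - ?K) \<inter> supp_subst \<rho> = {}"
    by (rule is_perm_avoiding_fixing[OF _ _ finite_supp_subst[OF \<rho>]]) blast
  have "\<pi> c \<notin> supp_subst \<rho>" if "c \<in> X \<union> set bs" for c
    using that \<pi>(2)[of c] \<pi>(3) K by (cases "c \<in> ?K") auto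
  then have X: "\<pi> ` X \<inter> supp_subst \<rho> = {}" and bs: "set (map \<pi> bs) \<inter> supp_subst \<rho> = {}" by auto
  have "tm_perm \<pi> ?u = ?u" "tm_perm \<pi> ?v = ?v" using \<pi>(1,2) by (simp_all add: tm_perm_ident)
  with eq have "tm_subst (lam_noms (map \<pi> bs) (tm_perm \<pi> s)) \<rho> =
      tm_subst (lam_noms (map \<pi> bs) (tm_perm \<pi> t)) \<rho>"
    by (simp add: perm_lam_noms \<pi>(1))
  then have "tm_subst (tm_perm \<pi> s) \<rho> = tm_subst (tm_perm \<pi> t) \<rho>"
    unfolding subst_lam_noms[OF \<rho> bs] by (rule lam_noms_inj)
  with \<pi>(1) X show ?thesis by (rule that)
qed

lemma nom_comp_unifier_solution:
  assumes \<sigma>: "is_subst \<sigma>" and fresh: "supp_subst \<sigma> \<inter> (supp s \<union> supp t) = {}"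
    and as: "distinct as"
    and unif: "unifier (lam_noms bs (tm_subst s \<sigma>)) (lam_noms bs (lam_noms as (tm_subst t \<sigma>))) \<rho>"
  shows "na_solution (NAbs (length as) s t) (nom_comp \<sigma> \<rho>)"
proof -
  have \<rho>: "is_subst \<rho>" using unif by (simp add: unifier_def)
  have "finite (supp s \<union> supp t \<union> supp_subst \<sigma> \<union> set as)"
    using \<sigma> by (simp add: finite_supp_subst)
  then obtain \<pi> where \<pi>: "is_perm \<pi>"
    and avoid: "\<pi> ` (supp s \<union> supp t \<union> supp_subst \<sigma> \<union> set as) \<inter> supp_subst \<rho> = {}"
    and eq: "tm_subst (tm_perm \<pi> (tm_subst s \<sigma>)) \<rho> =
      tm_subst (tm_perm \<pi> (lam_noms as (tm_subst t \<sigma>))) \<rho>"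
    by (rule unifier_lam_noms_strip[OF unif])
  let ?\<theta> = "comp_subst (perm_subst \<pi> \<sigma>) \<rho>"
  have "set (map \<pi> as) \<inter> supp_subst \<rho> = {}" using avoid by auto
  with eq have "tm_subst (tm_perm \<pi> s) ?\<theta> = lam_noms (map \<pi> as) (tm_subst (tm_perm \<pi> t) ?\<theta>)"
    using \<pi> \<rho> \<sigma> by (simp add: perm_lam_noms subst_lam_noms tm_perm_subst tm_subst_subst)
  moreover have "distinct (map \<pi> as)" using as \<pi> by (simp add: distinct_map inj_on_def)
  ultimately have "holds (subst_form (perm_form \<pi> (NAbs (length as) s t)) ?\<theta>)"
    unfolding perm_form.simps subst_form.simps holds.simps by (metis length_map)
  moreover have "\<pi> ` supp_form (NAbs (length as) s t) \<inter> supp_subst ?\<theta> = {}"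
  proof -
    have "supp_subst ?\<theta> \<subseteq> \<pi> ` supp_subst \<sigma> \<union> supp_subst \<rho>"
      using supp_comp_subst[OF \<rho>, of "perm_subst \<pi> \<sigma>"] by (simp add: supp_perm_subst \<pi>)
    moreover have "\<pi> ` (supp s \<union> supp t) \<inter> \<pi> ` supp_subst \<sigma> = {}" using fresh \<pi> by auto
    moreover have "\<pi> ` (supp s \<union> supp t) \<inter> supp_subst \<rho> = {}" using avoid by blast
    ultimately show ?thesis unfolding supp_form.simps by blast
  qed
  ultimately have "na_solution (NAbs (length as) s t) ?\<theta>"
    using \<pi> \<rho> \<sigma> by (simp add: na_solution_iff[OF _ \<pi>])
  moreover have "subst_equiv ?\<theta> (nom_comp \<sigma> \<rho>)"
    using avoid by (intro subst_equiv_nom_comp \<sigma> \<rho> \<pi>) auto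
  ultimately show ?thesis using na_solution_subst_equiv subst_equiv_sym by blast
qed


subsection \<open>Solutions up to renaming\<close>

lemma Funs_inject: "length As = length Bs \<Longrightarrow> Funs As C = Funs Bs D \<longleftrightarrow> As = Bs \<and> C = D"
  by (induction As Bs rule: list_induct2) auto

lemma is_perm_sending_list_fixing:
  assumes "distinct ds" "distinct cs" "map nty ds = map nty cs"
    and "finite K" "set cs \<inter> K = {}"
  obtains \<mu> where "is_perm \<mu>" "\<And>c. c \<in> K \<Longrightarrow> \<mu> c = c" "\<mu> ` (set ds - K) \<subseteq> set cs"
proof -
  have len: "length ds = length cs" using assms(3) by (rule map_eq_imp_length_eq)
  define f where "f = the \<circ> map_of (zip ds cs)"
  have f: "map f ds = cs"
    using len by (intro nth_equalityI) (auto simp: f_def map_of_zip_nth[OF len assms(1)])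
  have "distinct (map f ds)" using f assms(2) by simp
  then have "inj_on f (set ds - K)" by (auto simp: distinct_map inj_on_diff)
  moreover have "nty (f d) = nty d" if "d \<in> set ds" for d
  proof -
    have "map (nty \<circ> f) ds = map nty ds" using f assms(3) by (simp flip: map_map)
    with that show ?thesis by (simp add: map_eq_conv)
  qed
  moreover have "f ` set ds = set cs" using f by (metis set_map)
  ultimately have "\<exists>\<mu>. is_perm \<mu> \<and> (\<forall>d \<in> set ds - K. \<mu> d = f d) \<and> (\<forall>c\<in>K. \<mu> c = c)"
    using assms(4,5) by (intro is_perm_extends_fixing) auto
  then obtain \<mu> where \<mu>: "is_perm \<mu>" "\<And>d. d \<in> set ds - K \<Longrightarrow> \<mu> d = f d" "\<And>c. c \<in> K \<Longrightarrow> \<mu> c = c"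
    by blast
  have "\<mu> ` (set ds - K) \<subseteq> set cs" using \<mu>(2) \<open>f ` set ds = set cs\<close> by auto
  with \<mu>(1,3) show ?thesis by (rule that)
qed

lemma na_solution_disjoint:
  assumes "is_subst \<theta>" "supp_subst \<theta> \<inter> (supp s \<union> supp t) = {}" "na_solution (NAbs n s t) \<theta>"
  obtains ds where "length ds = n" "distinct ds" "tm_subst s \<theta> = lam_noms ds (tm_subst t \<theta>)"
proof -
  have "id ` supp_form (NAbs n s t) \<inter> supp_subst \<theta> = {}" using assms(2) by auto
  then have "holds (subst_form (perm_form id (NAbs n s t)) \<theta>)"
    using na_solution_iff[OF assms(1) is_perm_id] assms(3) by blast
  then show ?thesis using that by auto
qed

lemma lam_noms_selection:
  assumes \<theta>: "is_subst \<theta>" "supp_subst \<theta> \<inter> (supp s \<union> supp t) = {}"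
    and es: "distinct es" "length es = length cs" "tm_subst s \<theta> = lam_noms es (tm_subst t \<theta>)"
    and ty_s: "tm_ty s = Funs (map nty cs) (tm_ty t)"
    and cs: "distinct cs" "set cs \<inter> (supp s \<union> supp t) = {}"
  obtains \<mu> as where "is_perm \<mu>" "\<And>c. c \<in> supp s \<union> supp t \<Longrightarrow> \<mu> c = c" "as \<in> selections t cs"
    "tm_subst s (perm_subst \<mu> \<theta>) = lam_noms as (tm_subst t (perm_subst \<mu> \<theta>))"
proof -
  let ?X = "supp s \<union> supp t"
  have X: "finite ?X" by simp
  obtain ds where ds: "distinct ds" "map nty ds = map nty es"
    "lam_noms ds (tm_subst t \<theta>) = lam_noms es (tm_subst t \<theta>)"
    and "set ds \<inter> ?X \<subseteq> supp (tm_subst t \<theta>)" by (rule lam_noms_rename_avoiding[OF es(1) X])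
  then have ds_X: "set ds \<inter> ?X \<subseteq> supp t" using supp_tm_subst[OF \<theta>(1), of t] \<theta>(2) by blast
  have types: "map nty ds = map nty cs"
    using arg_cong[OF es(3), of tm_ty] ds(2) es(2) by (simp add: \<theta>(1) ty_s Funs_inject)
  then obtain \<mu> where \<mu>: "is_perm \<mu>" "\<And>c. c \<in> ?X \<Longrightarrow> \<mu> c = c" "\<mu> ` (set ds - ?X) \<subseteq> set cs"
    by (rule is_perm_sending_list_fixing[OF ds(1) cs(1) _ X cs(2)]) blast
  have "\<mu> d \<in> supp t \<union> set cs" if "d \<in> set ds" for d
    using that ds_X \<mu>(2)[of d] \<mu>(3) by (cases "d \<in> ?X") auto
  then have "map \<mu> ds \<in> selections t cs"
    using ds(1) types \<mu>(1) by (auto simp: selections_def distinct_map inj_on_def comp_def)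
  moreover have "tm_perm \<mu> s = s" "tm_perm \<mu> t = t" using \<mu>(1,2) by (simp_all add: tm_perm_ident)
  then have "tm_subst s (perm_subst \<mu> \<theta>) = lam_noms (map \<mu> ds) (tm_subst t (perm_subst \<mu> \<theta>))"
    using arg_cong[OF es(3), of "tm_perm \<mu>"] \<mu>(1) \<theta>(1)
    by (simp add: tm_perm_subst perm_lam_noms flip: ds(3))
  ultimately show ?thesis using that[OF \<mu>(1,2)] by blast
qed

lemma na_solution_selection:
  assumes solution: "na_solution (NAbs (length cs) s t) \<rho>"
    and ty_s: "tm_ty s = Funs (map nty cs) (tm_ty t)"
    and cs: "distinct cs" "set cs \<inter> (supp s \<union> supp t) = {}"
  obtains \<mu> as where "is_perm \<mu>" "as \<in> selections t cs"
    "tm_subst s (perm_subst \<mu> \<rho>) = lam_noms as (tm_subst t (perm_subst \<mu> \<rho>))"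
    "supp_subst (perm_subst \<mu> \<rho>) \<inter> (supp s \<union> supp t) = {}"
proof -
  let ?X = "supp s \<union> supp t"
  have \<rho>: "is_subst \<rho>" using solution by (simp add: na_solution_def)
  have X: "finite ?X" by simp
  obtain \<pi> where \<pi>: "is_perm \<pi>" "\<pi> ` supp_subst \<rho> \<inter> ?X = {}"
    by (rule is_perm_avoiding[OF finite_supp_subst[OF \<rho>] X])
  let ?\<theta> = "perm_subst \<pi> \<rho>"
  have \<theta>: "is_subst ?\<theta>" "supp_subst ?\<theta> \<inter> ?X = {}" using \<pi> \<rho> by (simp_all add: supp_perm_subst)
  have "na_solution (NAbs (length cs) s t) ?\<theta>"
    by (rule na_solution_subst_equiv[OF solution subst_equiv_perm_subst[OF \<pi>(1)]])
  with \<theta> obtain es where "length es = length cs" "distinct es"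
    "tm_subst s ?\<theta> = lam_noms es (tm_subst t ?\<theta>)" by (rule na_solution_disjoint)
  then obtain \<mu> as where \<mu>: "is_perm \<mu>" "\<And>c. c \<in> ?X \<Longrightarrow> \<mu> c = c" and as: "as \<in> selections t cs"
    and eq: "tm_subst s (perm_subst \<mu> ?\<theta>) = lam_noms as (tm_subst t (perm_subst \<mu> ?\<theta>))"
    using lam_noms_selection[OF \<theta> _ _ _ ty_s cs] by metis
  have "\<mu> ` supp_subst ?\<theta> \<inter> \<mu> ` ?X = {}" using \<theta>(2) \<mu>(1) by auto
  moreover have "\<mu> ` ?X = ?X" using \<mu>(2) by force
  ultimately have "supp_subst (perm_subst \<mu> ?\<theta>) \<inter> ?X = {}" by (simp add: supp_perm_subst \<mu>(1))
  moreover have "perm_subst \<mu> ?\<theta> = perm_subst (\<mu> \<circ> \<pi>) \<rho>"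
    using \<mu>(1) \<pi>(1) by (simp add: perm_subst_perm)
  ultimately show ?thesis using that[of "\<mu> \<circ> \<pi>" as] \<mu>(1) \<pi>(1) as eq by simp
qed


subsection \<open>Raising\<close>

locale raised_problem =
  fixes \<Sigma> :: "var set" and s t :: "'k::signature tm" and cs :: "nom list" and prime :: "var \<Rightarrow> var"
  assumes finite_\<Sigma>: "finite \<Sigma>"
    and fv_\<Sigma>: "fv s \<union> fv t \<subseteq> \<Sigma>"
    and ty_s: "tm_ty s = Funs (map nty cs) (tm_ty t)"
    and distinct_cs: "distinct cs"
    and fresh_cs: "set cs \<inter> (supp s \<union> supp t) = {}"
    and inj_prime: "inj_on prime \<Sigma>"
    and vty_prime: "\<And>h. h \<in> \<Sigma> \<Longrightarrow> vty (prime h) = Funs (map nty cs) (vty h)"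
begin

abbreviation \<sigma> :: "'k subst" where "\<sigma> \<equiv> raising \<Sigma> prime cs"

lemma raising_apps:
  assumes "h \<in> \<Sigma>"
  shows "\<sigma> h = tm_apps (tm_var (prime h)) cs"
proof -
  have "represents (foldl App (Free (prime h)) (map Nom cs)) (tm_apps (tm_var (prime h)) cs :: 'k tm)"
    using assms by (intro represents_apps[OF represents_var]) (simp add: vty_prime)
  then show ?thesis using assms by (simp add: raising_def represents_def)
qed

lemma is_subst_raising: "is_subst \<sigma>"
proof (rule is_substI[OF _ finite_\<Sigma>])
  show "tm_ty (\<sigma> h) = vty h" for h
    using raising_apps[of h] vty_prime[of h]
    by (cases "h \<in> \<Sigma>") (simp_all add: tm_ty_apps raising_def)
qed (simp add: raising_def)

lemma supp_raising: "supp_subst \<sigma> \<subseteq> set cs"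
proof -
  have "supp (\<sigma> h) \<subseteq> set cs" for h
    using raising_apps[of h] supp_apps[of "tm_var (prime h)" cs "vty h"] vty_prime[of h]
    by (cases "h \<in> \<Sigma>") (simp_all add: raising_def)
  then show ?thesis by (auto simp: supp_subst_def)
qed

lemma nom_comp_raising:
  assumes \<theta>: "is_subst \<theta>"
  obtains \<pi> where "is_perm \<pi>"
    "\<And>h. h \<in> \<Sigma> \<Longrightarrow> nom_comp \<sigma> \<theta> h = tm_apps (\<theta> (prime h)) (map \<pi> cs)"
proof -
  obtain \<pi> where \<pi>: "is_perm \<pi>" "nom_comp \<sigma> \<theta> = comp_subst (perm_subst \<pi> \<sigma>) \<theta>"
    using nom_comp_choice[OF is_subst_raising \<theta>] by metis

  have "nom_comp \<sigma> \<theta> h = tm_apps (\<theta> (prime h)) (map \<pi> cs)" if h: "h \<in> \<Sigma>" for h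
  proof -
    have "nom_comp \<sigma> \<theta> h = tm_subst (tm_apps (tm_var (prime h)) (map \<pi> cs)) \<theta>"
      using perm_apps[of \<pi> "tm_var (prime h) :: 'k tm" cs "vty h"] vty_prime[OF h] \<pi>(1)
      by (simp add: \<pi>(2) comp_subst_def perm_subst_def raising_apps h)
    also have "\<dots> = tm_apps (\<theta> (prime h)) (map \<pi> cs)"
      using subst_apps[OF \<theta>, of "tm_var (prime h)" "map \<pi> cs" "vty h"] vty_prime[OF h] \<pi>(1) \<theta>
      by (simp add: comp_def)
    finally show ?thesis .
  qed
  with \<pi>(1) show ?thesis by (rule that)
qed

definition lower :: "'k subst \<Rightarrow> 'k subst" where
  "lower \<rho> = (\<lambda>x. if x \<in> prime ` \<Sigma> then lam_noms cs (\<rho> (the_inv_into \<Sigma> prime x)) else tm_var x)"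

lemma lower_prime: "h \<in> \<Sigma> \<Longrightarrow> lower \<rho> (prime h) = lam_noms cs (\<rho> h)"
  by (simp add: lower_def the_inv_into_f_f[OF inj_prime])

lemma is_subst_lower:
  assumes "is_subst \<rho>"
  shows "is_subst (lower \<rho>)"
proof (rule is_substI)
  show "tm_ty (lower \<rho> x) = vty x" for x
  proof (cases "x \<in> prime ` \<Sigma>")
    case True
    then show ?thesis using lower_prime vty_prime is_subst_ty[OF assms] by auto
  qed (simp add: lower_def)
  show "finite (prime ` \<Sigma>)" using finite_\<Sigma> by simp
qed (simp add: lower_def)

lemma supp_lower: "supp_subst (lower \<rho>) \<subseteq> supp_subst \<rho> - set cs"
proof -
  have "supp (lower \<rho> x) \<subseteq> supp_subst \<rho> - set cs" for x
    using supp_lam_noms[of cs "\<rho> (the_inv_into \<Sigma> prime x)"]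
      supp_subset_supp_subst[of \<rho> "the_inv_into \<Sigma> prime x"]
    by (auto simp: lower_def)
  then show ?thesis by (auto simp: supp_subst_def)
qed

lemma apps_lower: "h \<in> \<Sigma> \<Longrightarrow> tm_apps (lower \<rho> (prime h)) cs = \<rho> h"
  by (simp add: lower_prime apps_lam_noms)

lemma apps_perm_lower:
  assumes "is_subst \<rho>" "renaming \<kappa>" "h \<in> \<Sigma>"
  shows "tm_apps (tm_perm \<kappa> (lower \<rho> (prime h))) (map \<kappa> cs) = tm_perm \<kappa> (\<rho> h)"
  using perm_apps[OF assms(2), of "lower \<rho> (prime h)" cs "vty h"] assms
  by (simp add: is_subst_ty[OF is_subst_lower] vty_prime apps_lower)

lemma subst_raising_lower:
  assumes "is_subst \<rho>" "fv u \<subseteq> \<Sigma>"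
  shows "tm_subst (tm_subst u \<sigma>) (lower \<rho>) = tm_subst u \<rho>"
proof -
  note lower = is_subst_lower[OF assms(1)]
  have "comp_subst \<sigma> (lower \<rho>) h = \<rho> h" if "h \<in> \<Sigma>" for h
    using that subst_apps[OF lower, of "tm_var (prime h)" cs "vty h"]
    by (simp add: comp_subst_def raising_apps vty_prime lower apps_lower)
  then show ?thesis
    unfolding tm_subst_subst[OF is_subst_raising lower]
    using assms by (intro tm_subst_cong is_subst_comp is_subst_raising lower) auto
qed

lemma unifier_lower:
  assumes \<rho>: "is_subst \<rho>" and eq: "tm_subst s \<rho> = lam_noms as (tm_subst t \<rho>)"
    and disjoint: "supp_subst \<rho> \<inter> (supp s \<union> supp t) = {}"
    and as: "set as \<subseteq> supp t \<union> set cs"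
    and bs: "set bs \<subseteq> supp (tm_subst s \<sigma>) \<union> supp (tm_subst t \<sigma>)"
  shows "unifier (lam_noms bs (tm_subst s \<sigma>)) (lam_noms bs (lam_noms as (tm_subst t \<sigma>))) (lower \<rho>)"
proof -
  let ?F = "supp s \<union> supp t \<union> set cs"
  note lower = is_subst_lower[OF \<rho>]
  have fresh: "supp_subst (lower \<rho>) \<inter> ?F = {}" using supp_lower[of \<rho>] disjoint by blast
  have raised: "supp (tm_subst s \<sigma>) \<union> supp (tm_subst t \<sigma>) \<subseteq> ?F"
    using supp_tm_subst[OF is_subst_raising] supp_raising by blast
  have "tm_subst (tm_subst s \<sigma>) (lower \<rho>) = lam_noms as (tm_subst (tm_subst t \<sigma>) (lower \<rho>))"
    using eq fv_\<Sigma> by (simp add: subst_raising_lower[OF \<rho>])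
  moreover have "set as \<inter> supp_subst (lower \<rho>) = {}" "set bs \<inter> supp_subst (lower \<rho>) = {}"
    using as bs raised fresh by blast+
  moreover have "supp (lam_noms bs (tm_subst s \<sigma>)) \<union> supp (lam_noms bs (lam_noms as (tm_subst t \<sigma>)))
      \<subseteq> ?F"
    using supp_lam_noms[of bs] supp_lam_noms[of as "tm_subst t \<sigma>"] raised by blast
  ultimately show ?thesis using fresh by (auto simp: unifier_def subst_lam_noms lower)
qed

lemma complete_unifiers_less_general:
  assumes \<rho>: "is_subst \<rho>" and unif: "unifier u v (lower \<rho>)"
    and complete: "complete_unifiers (prime ` \<Sigma>) u v U"
  shows "\<exists>\<theta>\<in>U. less_general_on \<Sigma> \<rho> (nom_comp \<sigma> \<theta>)"
proof -
  have "finite (prime ` \<Sigma>)" using finite_\<Sigma> by simp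
  then obtain \<theta> where "\<theta> \<in> U" and cover: "\<And>\<kappa> Y. renaming \<kappa> \<Longrightarrow> finite Y \<Longrightarrow>
      \<kappa> ` supp_subst (lower \<rho>) \<inter> Y = {} \<Longrightarrow> \<exists>\<gamma>. is_subst \<gamma> \<and> supp_subst \<gamma> \<inter> Y = {} \<and>
        (\<forall>x \<in> prime ` \<Sigma>. comp_subst \<theta> \<gamma> x = tm_perm \<kappa> (lower \<rho> x))"
    by (rule complete_unifiers_cover[OF complete unif]) blast
  have \<theta>: "is_subst \<theta>" using complete_unifiersD[OF complete \<open>\<theta> \<in> U\<close>] by (simp add: unifier_def)
  obtain \<pi> where \<pi>: "is_perm \<pi>"
    and \<sigma>\<theta>: "\<And>h. h \<in> \<Sigma> \<Longrightarrow> nom_comp \<sigma> \<theta> h = tm_apps (\<theta> (prime h)) (map \<pi> cs)"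
    by (rule nom_comp_raising[OF \<theta>]) blast
  let ?Y = "supp_subst \<theta> \<union> \<pi> ` set cs"
  have Y: "finite ?Y" using \<theta> by (simp add: finite_supp_subst)
  obtain \<kappa> where \<kappa>: "is_perm \<kappa>" "\<And>c. c \<in> set cs \<Longrightarrow> \<kappa> c = \<pi> c"
    and avoid: "\<kappa> ` supp_subst (lower \<rho>) \<inter> ?Y = {}"
    by (rule is_perm_agreeing_avoiding[OF \<pi> finite_supp_subst[OF is_subst_lower[OF \<rho>]]
        finite_set[of cs] Y]) (use supp_lower in blast)+
  obtain \<gamma> where \<gamma>: "is_subst \<gamma>" "supp_subst \<gamma> \<inter> ?Y = {}"
    and \<theta>\<gamma>: "\<And>h. h \<in> \<Sigma> \<Longrightarrow> comp_subst \<theta> \<gamma> (prime h) = tm_perm \<kappa> (lower \<rho> (prime h))"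
    using cover[OF is_perm_renaming[OF \<kappa>(1)] Y avoid] by auto
  have types: "tm_ty (\<theta> (prime h)) = Funs (map nty (map \<pi> cs)) (vty h)" if "h \<in> \<Sigma>" for h
    using that \<pi> by (simp add: is_subst_ty[OF \<theta>] vty_prime comp_def)
  have "less_general_on \<Sigma> \<rho> (nom_comp \<sigma> \<theta>)"
  proof (rule less_general_onI[OF is_subst_nom_comp[OF is_subst_raising \<theta>] \<gamma>(1) _ \<kappa>(1)])
    have "supp (nom_comp \<sigma> \<theta> h) \<subseteq> ?Y" if "h \<in> \<Sigma>" for h
      using supp_apps[OF types[OF that]] supp_subset_supp_subst[of \<theta> "prime h"]
      by (auto simp: \<sigma>\<theta>[OF that])
    then show "supp_subst (restr \<Sigma> (nom_comp \<sigma> \<theta>)) \<inter> supp_subst \<gamma> = {}"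
      using \<gamma>(2) by (fastforce simp: supp_restr)
    fix h assume h: "h \<in> \<Sigma>"
    have "comp_subst (nom_comp \<sigma> \<theta>) \<gamma> h = tm_apps (tm_perm \<kappa> (lower \<rho> (prime h))) (map \<pi> cs)"
      using subst_apps[OF \<gamma>(1) types[OF h]] \<theta>\<gamma>[OF h] by (simp add: comp_subst_def \<sigma>\<theta>[OF h])
    also have "map \<pi> cs = map \<kappa> cs" using \<kappa>(2) by simp
    also have "tm_apps (tm_perm \<kappa> (lower \<rho> (prime h))) (map \<kappa> cs) = tm_perm \<kappa> (\<rho> h)"
      by (rule apps_perm_lower[OF \<rho> is_perm_renaming[OF \<kappa>(1)] h])
    finally show "comp_subst (nom_comp \<sigma> \<theta>) \<gamma> h = tm_perm \<kappa> (\<rho> h)" .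
  qed
  then show ?thesis using \<open>\<theta> \<in> U\<close> by (rule bexI)
qed

lemma raised_unifiers_sound:
  assumes "as \<in> selections t cs"
    and "unifier (lam_noms bs (tm_subst s \<sigma>)) (lam_noms bs (lam_noms as (tm_subst t \<sigma>))) \<rho>"
  shows "na_solution (NAbs (length cs) s t) (nom_comp \<sigma> \<rho>)"
proof -
  have "distinct as" "length as = length cs"
    using assms(1) by (auto simp: selections_def dest: map_eq_imp_length_eq)
  moreover have "supp_subst \<sigma> \<inter> (supp s \<union> supp t) = {}" using supp_raising fresh_cs by blast
  ultimately show ?thesis using nom_comp_unifier_solution[OF is_subst_raising _ _ assms(2)] by simp
qed

lemma raised_unifiers_complete:
  assumes solution: "na_solution (NAbs (length cs) s t) \<rho>"
    and bs: "\<And>as. as \<in> selections t cs \<Longrightarrow>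
      set (bs as) \<subseteq> supp (tm_subst s \<sigma>) \<union> supp (tm_subst t \<sigma>)"
    and U: "\<And>as. as \<in> selections t cs \<Longrightarrow> complete_unifiers (prime ` \<Sigma>)
      (lam_noms (bs as) (tm_subst s \<sigma>)) (lam_noms (bs as) (lam_noms as (tm_subst t \<sigma>))) (U as)"
  shows "\<exists>as \<in> selections t cs. \<exists>\<theta> \<in> U as. less_general_on \<Sigma> \<rho> (nom_comp \<sigma> \<theta>)"
proof -
  obtain \<mu> as where \<mu>: "is_perm \<mu>" and as: "as \<in> selections t cs"
    and eq: "tm_subst s (perm_subst \<mu> \<rho>) = lam_noms as (tm_subst t (perm_subst \<mu> \<rho>))"
    and disjoint: "supp_subst (perm_subst \<mu> \<rho>) \<inter> (supp s \<union> supp t) = {}"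
    by (rule na_solution_selection[OF solution ty_s distinct_cs fresh_cs])
  have \<mu>\<rho>: "is_subst (perm_subst \<mu> \<rho>)" using solution \<mu> by (simp add: na_solution_def)
  have "set as \<subseteq> supp t \<union> set cs" using as by (simp add: selections_def)
  from complete_unifiers_less_general[OF \<mu>\<rho> unifier_lower[OF \<mu>\<rho> eq disjoint this bs[OF as]] U[OF as]]
  show ?thesis
    using as less_general_on_subst_equiv[OF subst_equiv_sym[OF subst_equiv_perm_subst[OF \<mu>]]] by blast
qed

lemma raised_unifiers_complete_na_solutions:
  assumes bs: "\<And>as. as \<in> selections t cs \<Longrightarrow>
      set (bs as) \<subseteq> supp (tm_subst s \<sigma>) \<union> supp (tm_subst t \<sigma>)"
    and U: "\<And>as. as \<in> selections t cs \<Longrightarrow> complete_unifiers (prime ` \<Sigma>)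
      (lam_noms (bs as) (tm_subst s \<sigma>)) (lam_noms (bs as) (lam_noms as (tm_subst t \<sigma>))) (U as)"
  shows "complete_na_solutions \<Sigma> (NAbs (length cs) s t)
    {nom_comp \<sigma> \<rho> | \<rho>. \<exists>as \<in> selections t cs. \<rho> \<in> U as}"
  unfolding complete_na_solutions_def
proof (intro conjI ballI allI impI)
  fix \<theta> assume "\<theta> \<in> {nom_comp \<sigma> \<rho> | \<rho>. \<exists>as \<in> selections t cs. \<rho> \<in> U as}"
  then obtain as \<rho> where "as \<in> selections t cs" "\<rho> \<in> U as" "\<theta> = nom_comp \<sigma> \<rho>" by blast
  then show "na_solution (NAbs (length cs) s t) \<theta>"
    using raised_unifiers_sound[OF _ complete_unifiersD[OF U]] by simp
next
  fix \<rho> assume "na_solution (NAbs (length cs) s t) \<rho>"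
  from raised_unifiers_complete[OF this bs U]
  show "\<exists>\<theta> \<in> {nom_comp \<sigma> \<rho> | \<rho>. \<exists>as \<in> selections t cs. \<rho> \<in> U as}. less_general_on \<Sigma> \<rho> \<theta>"
    by blast
qed

end

theorem theorem3p14:
  fixes \<Sigma> :: "var set"
    and s t :: "'k::signature tm"
    and \<tau>s :: "ty list" and \<tau> :: ty
    and cs :: "nom list"
    and prime :: "var \<Rightarrow> var"
    and bs :: "nom list \<Rightarrow> nom list"
    and CSU :: "'k tm \<Rightarrow> 'k tm \<Rightarrow> 'k subst set"
  assumes "finite \<Sigma>"
    and "fv s \<union> fv t \<subseteq> \<Sigma>"
    and "tm_ty s = Funs \<tau>s \<tau>"
    and "tm_ty t = \<tau>"
    and "distinct cs"
    and "map nty cs = \<tau>s"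
    and "set cs \<inter> supp_form (NAbs (length \<tau>s) s t) = {}"
    and "inj_on prime \<Sigma>"
    and "prime ` \<Sigma> \<inter> \<Sigma> = {}"
    and "\<And>h. h \<in> \<Sigma> \<Longrightarrow> vty (prime h) = Funs \<tau>s (vty h)"
    and "\<And>as. as \<in> selections t cs \<Longrightarrow>
          distinct (bs as) \<and>
          set (bs as) = (supp (tm_subst s (raising \<Sigma> prime cs)) \<union>
                         supp (tm_subst t (raising \<Sigma> prime cs))) - set as"
    and "\<And>u v. complete_unifiers (prime ` \<Sigma>) u v (CSU u v)"
  shows "complete_na_solutions \<Sigma> (NAbs (length \<tau>s) s t)
          (solution_set prime cs bs CSU \<Sigma> s t)"
proof -
  interpret raised_problem \<Sigma> s t cs prime
    using assms(1-8,10) by unfold_locales auto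
  let ?U = "\<lambda>as. CSU (lam_noms (bs as) (tm_subst s \<sigma>))
    (lam_noms (bs as) (lam_noms as (tm_subst t \<sigma>)))"
  have "complete_na_solutions \<Sigma> (NAbs (length cs) s t)
      {nom_comp \<sigma> \<rho> | \<rho>. \<exists>as \<in> selections t cs. \<rho> \<in> ?U as}"
    using assms(11,12) by (intro raised_unifiers_complete_na_solutions[of bs]) auto
  moreover have "solution_set prime cs bs CSU \<Sigma> s t =
      {nom_comp \<sigma> \<rho> | \<rho>. \<exists>as \<in> selections t cs. \<rho> \<in> ?U as}"
    by (auto simp: solution_set_def Let_def)
  moreover have "length \<tau>s = length cs" using assms(6) by auto
  ultimately show ?thesis by simp
qed

end
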